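(* Let $\alpha:\mathbb{R}\to(0,1)$ be an arbitrary function such that $$\alpha:=\limsup_{|x|\to\infty}\alpha(x)<1,$$ and let $\beta\in(0,1-\alpha)$ be arbitrary. Let $c:\mathbb{R}\to(0,\infty)$ be an arbitrary function and let $\{f_x:x\in\mathbb{R}\}$ be a family of probability density functions on $\mathbb{R}$ which satisfies conditions (C1)--(C5) listed in the context, and suppose there exists $a_0>0$ such that $$\liminf_{|x|\to\infty}\frac{\alpha(x)|x|^{\alpha(x)}}{c(x)}\int_{-a}^{a}\left(1-\left(1+\operatorname{sgn}(x)\frac{y}{1+|x|}\right)^{-\beta}\right)f_x(y)\,dy\;>\;-T(\alpha,\beta)$$ for all $a\ge a_0$. Then the Markov chain $\{X_n\}_{n\ge0}$ on $\mathbb{R}$ given by the transition kernel $p(x,dy)=f_x(y-x)\,dy$ is transient.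
   Context: The symbol $\alpha$ without an argument denotes the number $\limsup_{|x|\to\infty}\alpha(x)\in[0,1)$; $\lambda$ is Lebesgue measure on the Borel $\sigma$-algebra $\mathcal{B}(\mathbb{R})$; $C-x:=\{y-x: y\in C\}$; $[-k,k]^c$ is the complement of $[-k,k]$ in $\mathbb{R}$. Conditions: (C1) $x\mapsto f_x(y)$ is Borel measurable for every $y\in\mathbb{R}$. (C2) For every $x\in\mathbb{R}$, $f_x(y)\sim c(x)|y|^{-\alpha(x)-1}$ as $|y|\to\infty$, i.e. the ratio tends to $1$. (C3) There exists $k>0$ such that $\lim_{|y|\to\infty}\sup_{x\in[-k,k]^c}\left|f_x(y)\frac{|y|^{\alpha(x)+1}}{c(x)}-1\right|=0$. (C4) With the same $k$, $\inf_{x\in C}c(x)>0$ for every compact set $C\subseteq[-k,k]^c$. (C5) With the same $k$, there exists $l>0$ such that for every compact set $C\subseteq[-l,l]^c$ with $\lambda(C)>0$ we have $\inf_{x\in[-k,k]}\int_{C-x}f_x(y)\,dy>0$. For $\alpha\in[0,1)$ and $\beta\in(0,1-\alpha)$, $$T(\alpha,\beta):={}_2F_1(-\alpha,\beta,1-\alpha;1)+\beta B(1;\alpha+\beta,1-\alpha)-\alpha B(1;\alpha+\beta,1-\beta),$$ where ${}_2F_1(a,b,c;z)=\sum_{n\ge0}\frac{(a)_n(b)_n}{(c)_n}\frac{z^n}{n!}$, with $(w)_0=1$ and $(w)_n=w(w+1)\cdots(w+n-1)$, is the Gauss hypergeometric function, and $B(x;z,w)=\int_0^x t^{z-1}(1-t)^{w-1}\,dt$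 is the incomplete Beta function. A Markov chain $\{Y_n\}_{n\ge0}$ on $(\mathbb{R},\mathcal{B}(\mathbb{R}))$ is $\varphi$-irreducible if there exists a probability measure $\varphi$ on $\mathcal{B}(\mathbb{R})$ such that for every $x\in\mathbb{R}$ there exists $n\in\mathbb{N}$ such that $\varphi(B)>0$ implies $\mathbb{P}(Y_n\in B\mid Y_0=x)>0$. The chain is transient if it is $\varphi$-irreducible and there exists a countable cover of $\mathbb{R}$ by sets $\{B_j\}_{j\in\mathbb{N}}\subseteq\mathcal{B}(\mathbb{R})$ such that for each $j$ there is a finite constant $M_j\ge0$ with $\sum_{n=0}^\infty\mathbb{P}(Y_n\in B_j\mid Y_0=x)\le M_j$ for all $x\in\mathbb{R}$. *)

theory Defs
  imports "HOL-Probability.Probability"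
begin

section \<open>The constant $T(\alpha,\beta)$\<close>

definition hypergeo_2F1 :: "real \<Rightarrow> real \<Rightarrow> real \<Rightarrow> real \<Rightarrow> real" where
  "hypergeo_2F1 a b c z =
     (\<Sum>n. pochhammer a n * pochhammer b n / pochhammer c n * (z ^ n / fact n))"

definition incomplete_Beta :: "real \<Rightarrow> real \<Rightarrow> real \<Rightarrow> real" where
  "incomplete_Beta x z w = (LBINT t:{0..x}. t powr (z - 1) * (1 - t) powr (w - 1))"

definition T_const :: "real \<Rightarrow> real \<Rightarrow> real" where
  "T_const \<alpha> \<beta> =
     hypergeo_2F1 (-\<alpha>) \<beta> (1 - \<alpha>) 1
     + \<beta> * incomplete_Beta 1 (\<alpha> + \<beta>) (1 - \<alpha>)
     - \<alpha> * incomplete_Beta 1 (\<alpha> + \<beta>) (1 - \<beta>)"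

section \<open>Markov chains on the real line\<close>

definition history :: "'w measure \<Rightarrow> (nat \<Rightarrow> 'w \<Rightarrow> real) \<Rightarrow> nat \<Rightarrow> 'w measure" where
  "history M Y n =
     sigma (space M) {Y i -` A \<inter> space M | i A. i \<le> n \<and> A \<in> sets borel}"

text \<open>
  A time-homogeneous Markov chain \<open>Y\<close> with transition kernel \<open>K\<close> is given with all its starting
  points: \<open>P x\<close> is the law under which the chain starts in \<open>x\<close>, i.e. the conditional probability
  given \<open>Y 0 = x\<close>.  That \<open>K\<close> is a transition kernel includes Borel measurability of
  \<open>x \<mapsto> K x B\<close> for every Borel set \<open>B\<close>; this is the membership in
  \<open>borel \<rightarrow>\<^sub>M prob_algebra borel\<close>.
\<close>

definition markov_chain ::
    "(real \<Rightarrow> 'w measure) \<Rightarrow> (nat \<Rightarrow> 'w \<Rightarrow> real) \<Rightarrow> (real \<Rightarrow> real measure) \<Rightarrow> bool" where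
  "markov_chain P Y K \<longleftrightarrow>
     K \<in> borel \<rightarrow>\<^sub>M prob_algebra borel \<and>
     (\<forall>x. prob_space (P x) \<and>
          (\<forall>n. Y n \<in> borel_measurable (P x)) \<and>
          (AE \<omega> in P x. Y 0 \<omega> = x) \<and>
          (\<forall>n. \<forall>B\<in>sets borel.
             AE \<omega> in P x.
               real_cond_exp (P x) (history (P x) Y n) (\<lambda>\<omega>. indicator B (Y (Suc n) \<omega>)) \<omega>
               = measure (K (Y n \<omega>)) B))"

definition hit_prob ::
    "(real \<Rightarrow> 'w measure) \<Rightarrow> (nat \<Rightarrow> 'w \<Rightarrow> real) \<Rightarrow> nat \<Rightarrow> real \<Rightarrow> real set \<Rightarrow> ennreal" where
  "hit_prob P Y n x B = emeasure (P x) {\<omega> \<in> space (P x). Y n \<omega> \<in> B}"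

text \<open>The time \<open>n\<close> is positive and may depend on \<open>x\<close>, but not on \<open>B\<close>.\<close>

definition phi_irreducible :: "(real \<Rightarrow> 'w measure) \<Rightarrow> (nat \<Rightarrow> 'w \<Rightarrow> real) \<Rightarrow> bool" where
  "phi_irreducible P Y \<longleftrightarrow>
     (\<exists>\<phi>. prob_space \<phi> \<and> sets \<phi> = sets borel \<and>
        (\<forall>x. \<exists>n\<ge>1. \<forall>B\<in>sets borel. emeasure \<phi> B > 0 \<longrightarrow> hit_prob P Y n x B > 0))"

definition transient :: "(real \<Rightarrow> 'w measure) \<Rightarrow> (nat \<Rightarrow> 'w \<Rightarrow> real) \<Rightarrow> bool" where
  "transient P Y \<longleftrightarrow>
     phi_irreducible P Y \<and>
     (\<exists>B :: nat \<Rightarrow> real set.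
        (\<forall>j. B j \<in> sets borel) \<and> (\<Union>j. B j) = UNIV \<and>
        (\<forall>j. \<exists>M\<ge>0::real. \<forall>x. (\<Sum>n. hit_prob P Y n x (B j)) \<le> ennreal M))"

definition jump_kernel :: "(real \<Rightarrow> real \<Rightarrow> real) \<Rightarrow> real \<Rightarrow> real measure" where
  "jump_kernel f x = density lborel (\<lambda>y. ennreal (f x (y - x)))"

definition prob_density :: "(real \<Rightarrow> real) \<Rightarrow> bool" where
  "prob_density g \<longleftrightarrow>
     g \<in> borel_measurable borel \<and> (\<forall>y. 0 \<le> g y) \<and> (\<integral>\<^sup>+ y. ennreal (g y) \<partial>lborel) = 1"

end

theory Submission imports Defs begin

text \<open>
  Write \<open>u z = (1 + \<bar>z\<bar>) powr (- \<beta>)\<close>.  The proof uses the bounded function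
  \<open>w z = 1 - min (u z) (u r)\<close> with a large \<open>r\<close>.  If \<open>w\<close> is strictly subharmonic at every
  point, then the sets where one step raises the mean of \<open>w\<close> by at least \<open>1 / (j + 1)\<close> cover
  the line, and summing the increments of the mean of \<open>w\<close> along the chain, which is at most 1,
  bounds the potential of each of them (\<open>transient_if_bounded_strictly_subharmonic\<close>).
  Inside \<open>[-r, r]\<close> the function \<open>w\<close> attains its minimum, so there strictness only says that jumps
  far to the right have positive probability.  It remains to show that
  \<open>D x = \<integral> (1 - ((1 + \<bar>x + y\<bar>) / (1 + \<bar>x\<bar>)) powr (- \<beta>)) * f x y dy\<close> is positive when
  \<open>\<bar>x\<bar>\<close> is large.

  Put \<open>m = 1 + \<bar>x\<bar>\<close> and \<open>h v = 1 - \<bar>1 + v\<bar> powr (- \<beta>)\<close>.  For \<open>\<bar>y\<bar> \<le> a\<close> the integrand of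
  \<open>D x\<close> is the one in the drift hypothesis.  For \<open>\<bar>y\<bar> > a\<close> the inequality
  \<open>1 + \<bar>x + y\<bar> \<ge> \<bar>m + sgn x * y\<bar>\<close> gives the lower bound \<open>h (sgn x * y / m) * f x y\<close>, in which
  \<open>f x y\<close> agrees with \<open>c x * \<bar>y\<bar> powr (- \<alpha> x - 1)\<close> up to a small relative error that is uniform
  in \<open>x\<close>.  After rescaling by \<open>m\<close> this part becomes, up to that error,
  \<open>c x * m powr (- \<alpha> x)\<close> times the integral of \<open>h v * \<bar>v\<bar> powr (- \<alpha> x - 1)\<close> over
  \<open>\<bar>v\<bar> > a / m\<close> (\<open>relative_drift_ge\<close>).  Over the whole line this integral is
  \<open>T_const (\<alpha> x) \<beta> / \<alpha> x\<close> (\<open>integral_weighted_gain\<close>), and the missing part \<open>\<bar>v\<bar> \<le> a / m\<close> is not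
  positive because \<open>h v + h (- v) \<le> 0\<close> for \<open>0 < v < 1\<close>.

  The hypothesis compares with \<open>T_const\<close> at the limit superior \<open>\<alpha>\<^sub>0\<close>, the estimate produces it at
  \<open>\<alpha> x\<close>, which lies below a number \<open>b\<close> slightly larger than \<open>\<alpha>\<^sub>0\<close>.  So \<open>T_const\<close> has to decrease
  in its first argument and must not jump down to the right of \<open>\<alpha>\<^sub>0\<close>.  Both follow from a series:
  folding the line at 0, inverting \<open>{1<..}\<close> to \<open>{0<..<1}\<close> and expanding
  \<open>(1 - t) powr (- \<beta>) + (1 + t) powr (- \<beta>) = (\<Sum>n. d n * t ^ n)\<close> with \<open>d n \<ge> 0\<close> yields
  \<open>T_const \<alpha> \<beta> = 2 - \<alpha> * ((\<Sum>n. d (n + 1) / (n + 1 - \<alpha>)) + (\<Sum>n. d n / (n + \<alpha> + \<beta>)))\<close>,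
  where every single term depends monotonically on \<open>\<alpha>\<close> (\<open>T_const_series\<close>).

  Irreducibility takes two steps, with the uniform distribution on \<open>[0, 1]\<close> as reference measure:
  the first jump can go far to the right, and from there every point of \<open>[0, 1]\<close> is at a distance
  at which the jump density is positive.
\<close>

section \<open>Lebesgue integrals over subsets of the line\<close>

text \<open>
  Integrability and the value of the integral are carried together, so that a change of variables
  or an addition transports both at once.
\<close>
abbreviation has_set_integral :: "(real \<Rightarrow> real) \<Rightarrow> real \<Rightarrow> real set \<Rightarrow> bool" where
  "has_set_integral f I S \<equiv> has_bochner_integral lborel (\<lambda>x. indicator S x * f x) I"

lemma has_set_integral_iff_lebesgue:
  assumes f: "f \<in> borel_measurable borel" and S: "S \<in> sets borel"
  shows "has_set_integral f I S \<longleftrightarrow> f absolutely_integrable_on S \<and> integral S f = I"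
proof -
  have m: "(\<lambda>x. indicator S x *\<^sub>R f x) \<in> borel_measurable lborel"
    using f S by measurable
  have a: "f absolutely_integrable_on S \<longleftrightarrow> set_integrable lborel S f"
    unfolding set_integrable_def by (rule integrable_completion[OF m])
  show ?thesis
    unfolding a has_bochner_integral_iff
    using set_borel_integral_eq_integral(2)[of S f]
    by (auto simp: set_integrable_def set_lebesgue_integral_def)
qed

lemma has_set_integral_substitution:
  fixes f g g' :: "real \<Rightarrow> real"
  assumes f: "f \<in> borel_measurable borel" and h: "h \<in> borel_measurable borel"
    and S: "S \<in> sets borel" and R: "g ` S = R" "R \<in> sets borel"
    and d: "\<And>x. x \<in> S \<Longrightarrow> (g has_field_derivative g' x) (at x)"
    and inj: "inj_on g S"
    and eq: "\<And>x. x \<in> S \<Longrightarrow> \<bar>g' x\<bar> * f (g x) = h x"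
  shows "has_set_integral f I R \<longleftrightarrow> has_set_integral h I S"
proof -
  have "(\<lambda>x. \<bar>g' x\<bar> * f(g x)) absolutely_integrable_on S \<and>
           integral S (\<lambda>x. \<bar>g' x\<bar> * f (g x)) = I
     \<longleftrightarrow> f absolutely_integrable_on (g ` S) \<and> integral (g ` S) f = I"
    using S d by (intro has_absolute_integral_change_of_variables_1' inj) (auto intro: DERIV_subset)
  moreover have "(\<lambda>x. \<bar>g' x\<bar> * f(g x)) absolutely_integrable_on S \<longleftrightarrow> h absolutely_integrable_on S"
    by (intro set_integrable_cong) (auto simp: eq)
  moreover have "integral S (\<lambda>x. \<bar>g' x\<bar> * f (g x)) = integral S h"
    by (intro integral_cong) (auto simp: eq)
  ultimately show ?thesis
    using has_set_integral_iff_lebesgue[OF f R(2)] has_set_integral_iff_lebesgue[OF h S] R(1) by simp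
qed

lemma has_set_integral_nonneg:
  fixes f :: "real \<Rightarrow> real"
  assumes f: "f \<in> borel_measurable borel" and S: "S \<in> sets borel"
    and nn: "\<And>x. x \<in> S \<Longrightarrow> 0 \<le> f x" and I: "(f has_integral I) S"
  shows "has_set_integral f I S"
proof -
  have "f absolutely_integrable_on S"
    using I nn by (intro nonnegative_absolutely_integrable_1) auto
  then show ?thesis
    using has_set_integral_iff_lebesgue[OF f S] I by (auto simp: integral_unique)
qed

text \<open>
  The coefficients of the binomial series of \<open>(1 - t) powr (- \<beta>)\<close>.
\<close>
definition bcoeff :: "real \<Rightarrow> nat \<Rightarrow> real" where
  "bcoeff \<beta> n = pochhammer \<beta> n / fact n"

lemma bcoeff_0 [simp]: "bcoeff \<beta> 0 = 1"
  by (simp add: bcoeff_def)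

lemma bcoeff_Suc: "bcoeff \<beta> (Suc n) = bcoeff \<beta> n * (\<beta> + n) / (n + 1)"
  by (simp add: bcoeff_def pochhammer_Suc)

lemma bcoeff_nonneg: "0 < \<beta> \<Longrightarrow> 0 \<le> bcoeff \<beta> n"
  by (simp add: bcoeff_def pochhammer_nonneg)

lemma bcoeff_Suc_le: "0 < \<beta> \<Longrightarrow> \<beta> \<le> 1 \<Longrightarrow> bcoeff \<beta> (Suc n) \<le> bcoeff \<beta> n"
proof -
  assume b: "0 < \<beta>" "\<beta> \<le> 1"
  have "bcoeff \<beta> n * ((\<beta> + n) / (n + 1)) \<le> bcoeff \<beta> n * 1"
    using b by (intro mult_left_mono bcoeff_nonneg) auto
  then show ?thesis by (simp add: bcoeff_Suc)
qed

lemma binomial_series_neg: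
  assumes "\<bar>t\<bar> < (1::real)"
  shows "(\<lambda>n. bcoeff \<beta> n * t ^ n) sums (1 - t) powr (- \<beta>)"
proof -
  have "(- \<beta> gchoose n) * (- t) ^ n = bcoeff \<beta> n * t ^ n" for n
    using power_mult_distrib[of "-1::real" t n] power_mult_distrib[of "-1::real" "-1" n]
    by (simp add: gbinomial_pochhammer bcoeff_def)
  then show ?thesis
    using gen_binomial_real[of "- t" "- \<beta>"] assms by simp
qed

text \<open>
  Monotone convergence: as all terms are nonnegative, convergence of the integrated series and
  integrability of the sum are equivalent.  Both directions are used: a known Beta integral makes
  a series summable, and a summable series yields an integral.
\<close>
lemma has_set_integral_power_series:
  fixes d :: "nat \<Rightarrow> real" and g :: "real \<Rightarrow> real"
  assumes d: "\<And>n. 0 \<le> d n" and \<gamma>: "0 < \<gamma>"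
    and sums: "\<And>t. 0 < t \<Longrightarrow> t < 1 \<Longrightarrow> (\<lambda>n. d n * t ^ n) sums g t"
    and [measurable]: "g \<in> borel_measurable borel"
  shows "(\<lambda>n. d n / (real n + \<gamma>)) sums I \<longleftrightarrow> has_set_integral (\<lambda>t. g t * t powr (\<gamma> - 1)) I {0<..<1}"
proof -
  define w where "w = (\<lambda>t. indicator {0<..<1} t * (g t * t powr (\<gamma> - 1)))"
  have [measurable]: "w \<in> borel_measurable lborel"
    unfolding w_def by measurable
  have w0: "0 \<le> w t" for t
  proof (cases "0 < t \<and> t < 1")
    case True
    then have "0 \<le> g t"
      using sums[of t] d by (intro sums_le[OF _ sums_zero sums[of t]]) auto
    then show ?thesis by (simp add: w_def)
  next
    case False
    then show ?thesis by (auto simp: w_def)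
  qed
  have term_int: "(\<integral>\<^sup>+t. ennreal (indicator {0<..<1} t * (d n * t ^ n * t powr (\<gamma> - 1))) \<partial>lborel) = ennreal (d n / (real n + \<gamma>))" for n
  proof -
    have "((\<lambda>t. t powr (real n + \<gamma> - 1)) has_integral (1 powr (real n + \<gamma> - 1 + 1) / (real n + \<gamma> - 1 + 1))) {0..1}"
      using \<gamma> by (intro has_integral_powr_from_0) auto
    then have "((\<lambda>t. d n * t powr (real n + \<gamma> - 1)) has_integral (d n * (1 / (real n + \<gamma>)))) {0<..<1}"
      by (intro has_integral_mult_right) (simp add: has_integral_Icc_iff_Ioo)
    then have "has_set_integral (\<lambda>t. d n * t powr (real n + \<gamma> - 1)) (d n / (real n + \<gamma>)) {0<..<1}"
      using d by (intro has_set_integral_nonneg) auto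
    then have "(\<integral>\<^sup>+t. ennreal (indicator {0<..<1} t * (d n * t powr (real n + \<gamma> - 1))) \<partial>lborel) = ennreal (d n / (real n + \<gamma>))"
      using d by (subst nn_integral_eq_integral) (auto simp: has_bochner_integral_iff)
    moreover have "indicator {0<..<1} t * (d n * t powr (real n + \<gamma> - 1)) = indicator {0<..<1} t * (d n * t ^ n * t powr (\<gamma> - 1))" for t
    proof (cases "0 < t")
      case True
      have "t powr (real n + \<gamma> - 1) = t powr (real n + (\<gamma> - 1))" by (simp add: algebra_simps)
      also have "\<dots> = t ^ n * t powr (\<gamma> - 1)"
        using True by (simp only: powr_add powr_realpow)
      finally show ?thesis by simp
    qed auto
    ultimately show ?thesis by simp
  qed
  have nn: "(\<integral>\<^sup>+t. ennreal (w t) \<partial>lborel) = (\<Sum>n. ennreal (d n / (real n + \<gamma>)))"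
  proof -
    have "ennreal (w t) = (\<Sum>n. ennreal (indicator {0<..<1} t * (d n * t ^ n * t powr (\<gamma> - 1))))" for t
    proof (cases "0 < t \<and> t < 1")
      case True
      have "(\<lambda>n. d n * t ^ n * t powr (\<gamma> - 1)) sums (g t * t powr (\<gamma> - 1))"
        using sums True by (intro sums_mult2) auto
      then have "(\<Sum>n. ennreal (d n * t ^ n * t powr (\<gamma> - 1))) = ennreal (g t * t powr (\<gamma> - 1))"
        using d True by (intro suminf_ennreal_eq) auto
      then show ?thesis using True by (simp add: w_def)
    next
      case False
      then have "indicator {0<..<1} t = (0::real)" by auto
      then show ?thesis by (simp add: w_def)
    qed
    then have "(\<integral>\<^sup>+t. ennreal (w t) \<partial>lborel) = (\<Sum>n. (\<integral>\<^sup>+t. ennreal (indicator {0<..<1} t * (d n * t ^ n * t powr (\<gamma> - 1))) \<partial>lborel))"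
      by (simp add: nn_integral_suminf)
    then show ?thesis by (simp only: term_int)
  qed
  have nonneg: "0 \<le> d n / (real n + \<gamma>)" for n using d \<gamma> by simp
  show ?thesis
  proof
    assume s: "(\<lambda>n. d n / (real n + \<gamma>)) sums I"
    have "0 \<le> I" using s nonneg by (intro sums_le[OF _ sums_zero s]) auto
    moreover have "(\<integral>\<^sup>+t. ennreal (w t) \<partial>lborel) = ennreal I"
      unfolding nn using s nonneg by (intro suminf_ennreal_eq) auto
    ultimately show "has_set_integral (\<lambda>t. g t * t powr (\<gamma> - 1)) I {0<..<1}"
      using has_bochner_integral_nn_integral[of w lborel I] w0 by (simp add: w_def)
  next
    assume "has_set_integral (\<lambda>t. g t * t powr (\<gamma> - 1)) I {0<..<1}"
    then have i: "integrable lborel w" "integral\<^sup>L lborel w = I"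
      by (auto simp: has_bochner_integral_iff w_def)
    then have "(\<Sum>n. ennreal (d n / (real n + \<gamma>))) = ennreal I"
      using nn nn_integral_eq_integral[OF i(1)] w0 by simp
    moreover have "0 \<le> I" unfolding i(2)[symmetric] by (intro Bochner_Integration.integral_nonneg w0)
    moreover have sm: "summable (\<lambda>n. d n / (real n + \<gamma>))"
      using calculation(1) nonneg by (intro summable_suminf_not_top) auto
    ultimately have "(\<Sum>n. d n / (real n + \<gamma>)) = I"
      using nonneg by (simp add: suminf_ennreal2 suminf_nonneg)
    then show "(\<lambda>n. d n / (real n + \<gamma>)) sums I" using sm by (simp add: sums_iff)
  qed
qed

lemma has_set_integral_Beta:
  assumes "0 < a" "0 < (b::real)"
  shows "has_set_integral (\<lambda>t. t powr (a - 1) * (1 - t) powr (b - 1)) (Beta a b) {0<..<1}"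
    and "has_set_integral (\<lambda>t. t powr (a - 1) * (1 - t) powr (b - 1)) (Beta a b) {0..1}"
  using has_integral_Beta_real[OF assms]
  by (auto intro!: has_set_integral_nonneg simp: has_integral_Icc_iff_Ioo)

lemma incomplete_Beta_1: "0 < a \<Longrightarrow> 0 < b \<Longrightarrow> incomplete_Beta 1 a b = Beta a b"
  using has_set_integral_Beta(2)[of a b]
  by (simp add: incomplete_Beta_def set_lebesgue_integral_def has_bochner_integral_iff)

lemma bcoeff_sums_Beta:
  assumes "0 < \<beta>" "\<beta> < 1" "0 < \<gamma>"
  shows "(\<lambda>n. bcoeff \<beta> n / (real n + \<gamma>)) sums Beta \<gamma> (1 - \<beta>)"
proof (subst has_set_integral_power_series[where g = "\<lambda>t. (1 - t) powr (- \<beta>)"])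
  show "(\<lambda>n. bcoeff \<beta> n * t ^ n) sums (1 - t) powr - \<beta>" if "0 < t" "t < 1" for t
    using that by (intro binomial_series_neg) auto
  show "has_set_integral (\<lambda>t. (1 - t) powr - \<beta> * t powr (\<gamma> - 1)) (Beta \<gamma> (1 - \<beta>)) {0<..<1}"
    using has_set_integral_Beta(1)[of \<gamma> "1 - \<beta>"] assms by (simp add: mult.commute)
qed (use assms bcoeff_nonneg in auto)

lemma summable_bcoeff_Suc:
  assumes "0 < \<beta>" "\<beta> < 1" "\<alpha> < 1"
  shows "summable (\<lambda>n. bcoeff \<beta> (Suc n) / (real n + (1 - \<alpha>)))"
proof (rule summable_comparison_test)
  show "summable (\<lambda>n. bcoeff \<beta> n / (real n + (1 - \<alpha>)))"
    using bcoeff_sums_Beta[of \<beta> "1 - \<alpha>"] assms by (auto simp: sums_iff)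
  show "\<exists>N. \<forall>n\<ge>N. norm (bcoeff \<beta> (Suc n) / (real n + (1 - \<alpha>))) \<le> bcoeff \<beta> n / (real n + (1 - \<alpha>))"
    using assms bcoeff_nonneg[of \<beta>] bcoeff_Suc_le[of \<beta>] by (auto intro!: divide_right_mono)
qed

text \<open>
  The integrals of \<open>(\<Sum>n. d (n + 1) * t ^ n) * t powr (- \<alpha>)\<close> and of
  \<open>(\<Sum>n. d n * t ^ n) * t powr (\<gamma> - 1)\<close> over the unit interval, integrated term by term.
\<close>
definition tail_sum :: "(nat \<Rightarrow> real) \<Rightarrow> real \<Rightarrow> real" where
  "tail_sum d \<alpha> = (\<Sum>n. d (Suc n) / (real n + (1 - \<alpha>)))"

definition full_sum :: "(nat \<Rightarrow> real) \<Rightarrow> real \<Rightarrow> real" where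
  "full_sum d \<gamma> = (\<Sum>n. d n / (real n + \<gamma>))"

lemma full_sum_bcoeff: "0 < \<beta> \<Longrightarrow> \<beta> < 1 \<Longrightarrow> 0 < \<gamma> \<Longrightarrow> full_sum (bcoeff \<beta>) \<gamma> = Beta \<gamma> (1 - \<beta>)"
  using bcoeff_sums_Beta by (simp add: full_sum_def sums_iff)

text \<open>
  The quotient of the Pochhammer symbols of \<open>- \<alpha>\<close> and \<open>1 - \<alpha>\<close> telescopes to
  \<open>- \<alpha> / (n - \<alpha>)\<close>.
\<close>
lemma hypergeo_2F1_eq:
  assumes "0 < \<beta>" "\<beta> < 1" "0 \<le> \<alpha>" "\<alpha> < 1"
  shows "hypergeo_2F1 (- \<alpha>) \<beta> (1 - \<alpha>) 1 = 1 - \<alpha> * tail_sum (bcoeff \<beta>) \<alpha>"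
proof -
  have poch: "pochhammer (- \<alpha>) n / pochhammer (1 - \<alpha>) n = (- \<alpha>) / (real n - \<alpha>)" if "n > 0" for n
  proof -
    have "pochhammer (- \<alpha>) n * (real n - \<alpha>) = - \<alpha> * pochhammer (1 - \<alpha>) n"
      using pochhammer_absorb_comp[of "\<alpha>" n] pochhammer_rec[of "- \<alpha>" n] pochhammer_Suc[of "- \<alpha>" n]
      by (simp add: algebra_simps)
    moreover have "pochhammer (1 - \<alpha>) n > 0" using assms by (intro pochhammer_pos) auto
    moreover have "real n - \<alpha> \<noteq> 0" using assms that by auto
    ultimately show ?thesis by (simp add: field_simps)
  qed
  define u where "u n = pochhammer (- \<alpha>) n * pochhammer \<beta> n / pochhammer (1 - \<alpha>) n * (1 ^ n / fact n)" for n
  have uS: "u (Suc n) = - \<alpha> * (bcoeff \<beta> (Suc n) / (real n + (1 - \<alpha>)))" for n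
  proof -
    have "u (Suc n) = (pochhammer (- \<alpha>) (Suc n) / pochhammer (1 - \<alpha>) (Suc n)) * bcoeff \<beta> (Suc n)"
      by (simp add: u_def bcoeff_def)
    also have "\<dots> = (- \<alpha>) / (real (Suc n) - \<alpha>) * bcoeff \<beta> (Suc n)"
      by (subst poch) auto
    finally show ?thesis by (simp add: algebra_simps)
  qed
  have "(\<lambda>n. u (Suc n)) sums (- \<alpha> * tail_sum (bcoeff \<beta>) \<alpha>)"
    unfolding uS tail_sum_def using assms
    by (intro sums_mult summable_sums summable_bcoeff_Suc) auto
  then have "u sums (- \<alpha> * tail_sum (bcoeff \<beta>) \<alpha> + u 0)"
    by (simp add: sums_Suc_iff)
  moreover have "u 0 = 1" by (simp add: u_def)
  ultimately show ?thesis
    unfolding hypergeo_2F1_def u_def[symmetric] by (simp add: sums_iff)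
qed

lemma T_const_eq:
  assumes "0 < \<beta>" "\<beta> < 1" "0 \<le> \<alpha>" "\<alpha> < 1"
  shows "T_const \<alpha> \<beta> = 1 - \<alpha> * tail_sum (bcoeff \<beta>) \<alpha> + \<beta> * Beta (\<alpha> + \<beta>) (1 - \<alpha>) - \<alpha> * Beta (\<alpha> + \<beta>) (1 - \<beta>)"
  using assms by (simp add: T_const_def hypergeo_2F1_eq incomplete_Beta_1)

section \<open>The integral behind the constant\<close>

text \<open>
  The relative decrease of \<open>\<bar>z\<bar> powr (- \<beta>)\<close> under a jump from \<open>z\<close> to \<open>z * (1 + u)\<close>.
\<close>
definition jump_gain :: "real \<Rightarrow> real \<Rightarrow> real" where
  "jump_gain \<beta> u = 1 - \<bar>1 + u\<bar> powr (- \<beta>)"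

definition weighted_gain :: "real \<Rightarrow> real \<Rightarrow> real \<Rightarrow> real" where
  "weighted_gain \<alpha> \<beta> u = jump_gain \<beta> u * \<bar>u\<bar> powr (- \<alpha> - 1)"

lemma measurable_jump_gain [measurable]: "jump_gain \<beta> \<in> borel_measurable borel"
  unfolding jump_gain_def by measurable

lemma measurable_weighted_gain [measurable]: "weighted_gain \<alpha> \<beta> \<in> borel_measurable borel"
  unfolding weighted_gain_def by measurable

context
  fixes \<alpha> \<beta> :: real
  assumes \<alpha>: "0 < \<alpha>" "\<alpha> < 1" and \<beta>: "0 < \<beta>" "\<beta> < 1"
begin

text \<open>
  Integration by parts: \<open>\<Phi> s = (1 - s powr \<beta>) * (s / (1 - s)) powr \<alpha>\<close> vanishes at both ends of
  the unit interval, and its derivative is \<open>\<alpha>\<close> times the integrand minus \<open>\<beta>\<close> times the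
  integrand of the Beta function.
\<close>
lemma has_set_integral_Beta_by_parts:
  "has_set_integral (\<lambda>s. (1 - s powr \<beta>) * s powr (\<alpha> - 1) * (1 - s) powr (- \<alpha> - 1))
     (\<beta> * Beta (\<alpha> + \<beta>) (1 - \<alpha>) / \<alpha>) {0<..<1}"
proof -
  define \<Phi> where "\<Phi> s = (1 - s powr \<beta>) * s powr \<alpha> * (1 - s) powr (- \<alpha>)" for s :: real
  define \<phi> where "\<phi> s = \<alpha> * ((1 - s powr \<beta>) * s powr (\<alpha> - 1) * (1 - s) powr (- \<alpha> - 1))
      - \<beta> * (s powr (\<alpha> + \<beta> - 1) * (1 - s) powr (1 - \<alpha> - 1))" for s :: real
  \<comment> \<open>At 1 the factor \<open>1 - s powr \<beta> \<le> 1 - s\<close> compensates the singularity.\<close>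
  have "((\<lambda>s. \<Phi> s) \<longlongrightarrow> 0) (at 1 within {0..1})"
  proof (rule tendsto_sandwich)
    have le: "1 - s powr \<beta> \<le> 1 - s" if "s \<in> {0<..1}" for s :: real
      using powr_mono'[of \<beta> 1 s] that \<beta> by auto
    have "\<Phi> s \<le> (1 - s) powr (1 - \<alpha>)" if "s \<in> {0<..<1}" for s
    proof -
      have "\<Phi> s \<le> (1 - s) * 1 * (1 - s) powr (- \<alpha>)"
        unfolding \<Phi>_def using that \<alpha> \<beta>
        by (intro mult_mono mult_nonneg_nonneg le) (auto intro!: powr_le1)
      also have "\<dots> = (1 - s) powr (1 - \<alpha>)"
        using powr_mult_base[of "1 - s" "- \<alpha>"] that by simp
      finally show ?thesis .
    qed
    then show "\<forall>\<^sub>F s in at 1 within {0..1}. \<Phi> s \<le> (1 - s) powr (1 - \<alpha>)"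
      unfolding eventually_at by (intro exI[of _ 1]) (auto simp: dist_real_def)
    show "\<forall>\<^sub>F s in at 1 within {0..1}. 0 \<le> \<Phi> s"
      unfolding eventually_at \<Phi>_def using \<beta> by (intro exI[of _ 1]) (auto simp: dist_real_def intro!: powr_le1 mult_nonneg_nonneg)
    have "((\<lambda>s. (1 - s) powr (1 - \<alpha>)) \<longlongrightarrow> (1 - 1) powr (1 - \<alpha>)) (at 1 within {0..1})"
      using \<alpha> by (intro tendsto_powr' tendsto_intros) (auto simp: eventually_at intro!: exI[of _ 1])
    then show "((\<lambda>s::real. (1 - s) powr (1 - \<alpha>)) \<longlongrightarrow> 0) (at 1 within {0..1})" by simp
  qed simp
  then have "continuous (at 1 within {0..1}) \<Phi>"
    by (simp add: continuous_within \<Phi>_def[abs_def])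
  moreover have "continuous (at s within {0..1}) \<Phi>" if "s \<in> {0..<1}" for s
  proof -
    have "((\<lambda>s. (1 - s powr \<beta>) * s powr \<alpha> * (1 - s) powr (- \<alpha>)) \<longlongrightarrow> (1 - s powr \<beta>) * s powr \<alpha> * (1 - s) powr (- \<alpha>)) (at s within {0..1})"
      using that \<alpha> \<beta> by (intro tendsto_intros tendsto_powr') (auto simp: eventually_at intro!: exI[of _ 1])
    then show ?thesis by (simp add: continuous_within \<Phi>_def[abs_def])
  qed
  ultimately have cont: "continuous_on {0..1} \<Phi>"
    unfolding continuous_on_eq_continuous_within by (metis atLeastAtMost_iff atLeastLessThan_iff less_eq_real_def)
  have der: "(\<Phi> has_vector_derivative \<phi> s) (at s)" if s: "s \<in> {0<..<1}" for s
  proof -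
    have "(\<Phi> has_real_derivative
        (- (\<beta> * s powr (\<beta> - 1))) * (s powr \<alpha> * (1 - s) powr (- \<alpha>))
        + (1 - s powr \<beta>) * (\<alpha> * s powr (\<alpha> - 1) * (1 - s) powr (- \<alpha>) + s powr \<alpha> * (\<alpha> * (1 - s) powr (- \<alpha> - 1)))) (at s)"
      unfolding \<Phi>_def using s
      by (auto intro!: derivative_eq_intros simp: algebra_simps)
    moreover have "s powr (\<beta> - 1) * s powr \<alpha> = s powr (\<alpha> + \<beta> - 1)"
      by (simp add: powr_add[symmetric] algebra_simps)
    moreover have "s powr (\<alpha> - 1) * (1 - s) powr (- \<alpha>) + s powr \<alpha> * (1 - s) powr (- \<alpha> - 1)
        = s powr (\<alpha> - 1) * (1 - s) powr (- \<alpha> - 1)"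
    proof -
      have "s powr \<alpha> = s * s powr (\<alpha> - 1)" "(1 - s) powr (- \<alpha>) = (1 - s) * (1 - s) powr (- \<alpha> - 1)"
        using powr_mult_base[of s "\<alpha> - 1"] powr_mult_base[of "1 - s" "- \<alpha> - 1"] s by auto
      then show ?thesis by algebra
    qed
    ultimately have "(\<Phi> has_real_derivative \<phi> s) (at s)"
      unfolding \<phi>_def by (elim DERIV_cong) (simp add: algebra_simps flip: distrib_left)
    then show ?thesis by (simp add: has_real_derivative_iff_has_vector_derivative)
  qed
  have "(\<phi> has_integral (\<Phi> 1 - \<Phi> 0)) {0..1}"
    by (intro fundamental_theorem_of_calculus_interior cont der) auto
  then have "(\<phi> has_integral 0) {0..1}" by (simp add: \<Phi>_def)
  from has_integral_add[OF this has_integral_mult_right[OF has_integral_Beta_real[of "\<alpha> + \<beta>" "1 - \<alpha>"], of \<beta>]] \<alpha> \<beta>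
  have "((\<lambda>s. \<alpha> * ((1 - s powr \<beta>) * s powr (\<alpha> - 1) * (1 - s) powr (- \<alpha> - 1))) has_integral \<beta> * Beta (\<alpha> + \<beta>) (1 - \<alpha>)) {0..1}"
    by (simp add: \<phi>_def)
  from has_integral_mult_right[OF this, of "1 / \<alpha>"] \<alpha>
  have "((\<lambda>s. (1 - s powr \<beta>) * s powr (\<alpha> - 1) * (1 - s) powr (- \<alpha> - 1)) has_integral \<beta> * Beta (\<alpha> + \<beta>) (1 - \<alpha>) / \<alpha>) {0<..<1}"
    by (simp add: has_integral_Icc_iff_Ioo)
  then show ?thesis
    using \<beta> by (intro has_set_integral_nonneg) (auto intro!: mult_nonneg_nonneg powr_le1)
qed

text \<open>
  The three lemmas below compute the contributions of \<open>u > 0\<close> (substituting \<open>u = 1 / s - 1\<close>), of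
  \<open>-1 < u < 0\<close> and of \<open>u < -1\<close> (substituting \<open>u = - 1 / t\<close>).  They are the three summands of
  \<open>T_const \<alpha> \<beta> / \<alpha>\<close>, except that the constant term 1 of the hypergeometric series belongs
  to \<open>u < -1\<close>.
\<close>
lemma weighted_gain_right:
  "has_set_integral (weighted_gain \<alpha> \<beta>) (\<beta> * Beta (\<alpha> + \<beta>) (1 - \<alpha>) / \<alpha>) {0<..}"
proof (subst has_set_integral_substitution[where S = "{0<..<1}" and g = "\<lambda>s. 1 / s - 1" and g' = "\<lambda>s. - 1 / s\<^sup>2"])
  show "(\<lambda>s::real. 1 / s - 1) ` {0<..<1} = {0<..}"
  proof (intro equalityI subsetI)
    fix u :: real assume "u \<in> {0<..}"
    then show "u \<in> (\<lambda>s. 1 / s - 1) ` {0<..<1}"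
      by (intro image_eqI[of _ _ "1 / (1 + u)"]) auto
  qed (auto simp: field_simps)
  show "inj_on (\<lambda>s::real. 1 / s - 1) {0<..<1}" by (auto simp: inj_on_def)
  show "((\<lambda>s. 1 / s - 1) has_real_derivative - 1 / s\<^sup>2) (at s)" if "s \<in> {0<..<1}" for s :: real
    using that by (auto intro!: derivative_eq_intros simp: power2_eq_square)
  show "\<bar>- 1 / s\<^sup>2\<bar> * weighted_gain \<alpha> \<beta> (1 / s - 1) = (1 - s powr \<beta>) * s powr (\<alpha> - 1) * (1 - s) powr (- \<alpha> - 1)"
    if s: "s \<in> {0<..<1}" for s :: real
  proof -
    have gain: "jump_gain \<beta> (1 / s - 1) = 1 - s powr \<beta>"
      using s by (simp add: jump_gain_def powr_divide powr_minus)
    have abs: "\<bar>1 / s - 1\<bar> = (1 - s) / s" using s by (simp add: field_simps)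
    have sq: "\<bar>- 1 / s\<^sup>2\<bar> = s powr (-2)"
      using s by (simp add: powr_minus powr_numeral field_simps)
    have "s powr (-2) * ((1 - s) / s) powr (- \<alpha> - 1) = s powr (\<alpha> - 1) * (1 - s) powr (- \<alpha> - 1)"
      using s by (simp add: powr_divide powr_diff powr_minus powr_add powr_numeral power2_eq_square field_simps)
    then show ?thesis
      unfolding weighted_gain_def gain abs sq by (simp add: algebra_simps)
  qed
qed (auto intro: has_set_integral_Beta_by_parts)

lemma weighted_gain_left:
  "has_set_integral (\<lambda>t. weighted_gain \<alpha> \<beta> (- t)) (- tail_sum (bcoeff \<beta>) \<alpha>) {0<..<1}"
proof -
  have "has_set_integral (\<lambda>t. ((1 - t) powr (- \<beta>) - 1) / t * t powr ((1 - \<alpha>) - 1)) (tail_sum (bcoeff \<beta>) \<alpha>) {0<..<1}"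
  proof (subst has_set_integral_power_series[where d = "\<lambda>n. bcoeff \<beta> (Suc n)", symmetric])
    fix t :: real assume t: "0 < t" "t < 1"
    have "(\<lambda>n. bcoeff \<beta> (Suc n) * t ^ Suc n) sums ((1 - t) powr (- \<beta>) - 1)"
      using binomial_series_neg[of t \<beta>] t by (subst sums_Suc_iff) auto
    from sums_divide[OF this, of t] t
    show "(\<lambda>n. bcoeff \<beta> (Suc n) * t ^ n) sums (((1 - t) powr (- \<beta>) - 1) / t)" by simp
  next
    show "(\<lambda>n. bcoeff \<beta> (Suc n) / (real n + (1 - \<alpha>))) sums tail_sum (bcoeff \<beta>) \<alpha>"
      unfolding tail_sum_def using \<alpha> \<beta> by (intro summable_sums summable_bcoeff_Suc) auto
  qed (use \<alpha> \<beta> in \<open>auto intro: bcoeff_nonneg\<close>)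
  from has_bochner_integral_minus[OF this] show ?thesis
  proof (rule has_bochner_integral_cong[THEN iffD1, rotated 3])
    fix t :: real
    show "- (indicator {0<..<1} t * (((1 - t) powr - \<beta> - 1) / t * t powr (1 - \<alpha> - 1))) = indicator {0<..<1} t * weighted_gain \<alpha> \<beta> (- t)"
      by (auto simp: indicator_def weighted_gain_def jump_gain_def powr_diff powr_minus field_simps)
  qed auto
qed

lemma inverted_gain_left:
  "has_set_integral (\<lambda>t. weighted_gain \<alpha> \<beta> (- (1 / t)) / t\<^sup>2) (1 / \<alpha> - Beta (\<alpha> + \<beta>) (1 - \<beta>)) {0<..<1}"
proof -
  have "((\<lambda>t. t powr (\<alpha> - 1)) has_integral (1 powr (\<alpha> - 1 + 1) / (\<alpha> - 1 + 1))) {0..1}"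
    using \<alpha> by (intro has_integral_powr_from_0) auto
  then have "has_set_integral (\<lambda>t. t powr (\<alpha> - 1)) (1 / \<alpha>) {0<..<1}"
    by (intro has_set_integral_nonneg) (auto simp: has_integral_Icc_iff_Ioo)
  from has_bochner_integral_diff[OF this has_set_integral_Beta(1)[of "\<alpha> + \<beta>" "1 - \<beta>"]]
  have "has_bochner_integral lborel (\<lambda>t. indicator {0<..<1} t * t powr (\<alpha> - 1) -
       indicator {0<..<1} t * (t powr (\<alpha> + \<beta> - 1) * (1 - t) powr (1 - \<beta> - 1))) (1 / \<alpha> - Beta (\<alpha> + \<beta>) (1 - \<beta>))"
    using \<alpha> \<beta> by simp
  then show ?thesis
  proof (rule has_bochner_integral_cong[THEN iffD1, rotated 3])
    fix t :: real
    show "indicator {0<..<1} t * t powr (\<alpha> - 1) -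
       indicator {0<..<1} t * (t powr (\<alpha> + \<beta> - 1) * (1 - t) powr (1 - \<beta> - 1)) = indicator {0<..<1} t * (weighted_gain \<alpha> \<beta> (- (1 / t)) / t\<^sup>2)"
    proof (cases "t \<in> {0<..<1}")
      case True
      then have "\<bar>1 - 1 / t\<bar> = (1 - t) / t" by (simp add: field_simps abs_if)
      then show ?thesis
        using True by (simp add: weighted_gain_def jump_gain_def powr_divide powr_diff powr_add powr_minus power2_eq_square field_simps)
    qed auto
  qed auto
qed

end

lemma has_set_integral_reflect:
  assumes "f \<in> borel_measurable borel" "S \<in> sets borel" "uminus ` S = R" "R \<in> sets borel"
  shows "has_set_integral f I R \<longleftrightarrow> has_set_integral (\<lambda>t. f (- t)) I S"
  using assms(1-4) by (intro has_set_integral_substitution[where g = uminus and g' = "\<lambda>_. - 1"])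
    (auto intro!: derivative_eq_intros simp: inj_on_def)

lemma has_set_integral_invert:
  assumes [measurable]: "f \<in> borel_measurable borel"
  shows "has_set_integral f I {1<..} \<longleftrightarrow> has_set_integral (\<lambda>t. f (1 / t) / t\<^sup>2) I {0<..<1}"
proof (rule has_set_integral_substitution[where g = "\<lambda>t. 1 / t" and g' = "\<lambda>t. - 1 / t\<^sup>2"])
  show "(\<lambda>t::real. 1 / t) ` {0<..<1} = {1<..}"
  proof (intro equalityI subsetI)
    fix u :: real assume "u \<in> {1<..}"
    then show "u \<in> (\<lambda>s. 1 / s) ` {0<..<1}"
      by (intro image_eqI[of _ _ "1 / u"]) auto
  qed (auto simp: field_simps)
  show "((\<lambda>s. 1 / s) has_real_derivative - 1 / s\<^sup>2) (at s)" if "s \<in> {0<..<1}" for s :: real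
    using that by (auto intro!: derivative_eq_intros simp: power2_eq_square)
qed (auto simp: inj_on_def)

lemma has_set_integral_disjoint_Un:
  assumes "has_set_integral f I S" "has_set_integral f J R" "S \<inter> R = {}"
  shows "has_set_integral f (I + J) (S \<union> R)"
  using has_bochner_integral_add[OF assms(1,2)] assms(3)
  by (simp add: indicator_add[symmetric] distrib_right[symmetric])

lemma has_set_integral_fold:
  assumes f: "has_bochner_integral lborel f I" and [measurable]: "f \<in> borel_measurable borel"
  shows "has_set_integral (\<lambda>u. f u + f (- u)) I {0<..}"
proof -
  have i: "integrable lborel f" "integral\<^sup>L lborel f = I"
    using f by (auto simp: has_bochner_integral_iff)
  have r: "has_set_integral f (LBINT u. indicator {0<..} u * f u) {0<..}"
    using integrable_mult_indicator[OF _ i(1), of "{0<..}"] by (simp add: has_bochner_integral_iff)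
  have l: "has_set_integral f (LBINT u. indicator {..<0} u * f u) {..<0}"
    using integrable_mult_indicator[OF _ i(1), of "{..<0}"] by (simp add: has_bochner_integral_iff)
  have sum: "(LBINT u. indicator {0<..} u * f u) + (LBINT u. indicator {..<0} u * f u) = I"
  proof -
    have "(LBINT u. indicator {0<..} u * f u) + (LBINT u. indicator {..<0} u * f u)
        = (LBINT u. indicator {0<..} u * f u + indicator {..<0} u * f u)"
      using r l by (simp add: has_bochner_integral_iff)
    also have "\<dots> = (LBINT u. f u)"
      using AE_lborel_singleton[of "0::real"]
      by (intro integral_cong_AE) (auto simp: indicator_def elim!: eventually_mono)
    finally show ?thesis using i by simp
  qed
  have "uminus ` {0<..} = {..<(0::real)}"
    by (auto simp: image_iff intro!: bexI[of _ "- _"])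
  then have "has_set_integral (\<lambda>t. f (- t)) (LBINT u. indicator {..<0} u * f u) {0<..}"
    using l has_set_integral_reflect[of f "{0<..}" "{..<0}"] by simp
  from has_bochner_integral_add[OF r this] show ?thesis
    by (simp add: sum distrib_left)
qed

text \<open>
  Coefficients of the even function \<open>(1 - t) powr (- \<beta>) + (1 + t) powr (- \<beta>)\<close>.  The vanishing
  odd ones are kept, so that the same two sums serve this series and the binomial series.
\<close>
definition even_coeff :: "real \<Rightarrow> nat \<Rightarrow> real" where
  "even_coeff \<beta> n = bcoeff \<beta> n * (1 + (- 1) ^ n)"

lemma even_coeff_0 [simp]: "even_coeff \<beta> 0 = 2"
  by (simp add: even_coeff_def)

context
  fixes \<beta> :: real
  assumes \<beta>: "0 < \<beta>" "\<beta> < 1"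
begin

lemma even_coeff_bounds: "0 \<le> even_coeff \<beta> n" "even_coeff \<beta> n \<le> 2 * bcoeff \<beta> n"
  using bcoeff_nonneg[OF \<beta>(1), of n] by (cases "even n"; simp add: even_coeff_def)+

lemma even_coeff_sums:
  assumes "\<bar>t\<bar> < 1"
  shows "(\<lambda>n. even_coeff \<beta> n * t ^ n) sums ((1 - t) powr (- \<beta>) + (1 + t) powr (- \<beta>))"
proof -
  have "(\<lambda>n. bcoeff \<beta> n * t ^ n + bcoeff \<beta> n * (- t) ^ n) sums ((1 - t) powr (- \<beta>) + (1 - (- t)) powr (- \<beta>))"
    using assms by (intro sums_add binomial_series_neg) auto
  moreover have "bcoeff \<beta> n * t ^ n + bcoeff \<beta> n * (- t) ^ n = even_coeff \<beta> n * t ^ n" for n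
    using power_mult_distrib[of "-1::real" t n] by (simp add: even_coeff_def algebra_simps)
  ultimately show ?thesis by simp
qed

lemma summable_full_even_coeff: "0 < \<gamma> \<Longrightarrow> summable (\<lambda>n. even_coeff \<beta> n / (real n + \<gamma>))"
  using sums_summable[OF sums_mult[OF bcoeff_sums_Beta[OF \<beta>, of \<gamma>], of 2]] even_coeff_bounds
  by (rule_tac summable_comparison_test) (auto intro!: divide_right_mono)

lemma summable_tail_even_coeff: "a < 1 \<Longrightarrow> summable (\<lambda>n. even_coeff \<beta> (Suc n) / (real n + (1 - a)))"
  using summable_mult[OF summable_bcoeff_Suc[OF \<beta>, of a], of 2] even_coeff_bounds
  by (rule_tac summable_comparison_test) (auto intro!: divide_right_mono)

end

context
  fixes \<alpha> \<beta> :: real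
  assumes \<alpha>: "0 < \<alpha>" "\<alpha> < 1" and \<beta>: "0 < \<beta>" "\<beta> < 1"
begin

text \<open>
  The meaning of the constant: \<open>T_const \<alpha> \<beta> / \<alpha>\<close> is the total gain under the self-similar
  jump intensity \<open>\<bar>u\<bar> powr (- \<alpha> - 1)\<close>.
\<close>
proposition integral_weighted_gain:
  "has_bochner_integral lborel (weighted_gain \<alpha> \<beta>) (T_const \<alpha> \<beta> / \<alpha>)"
proof -
  have "uminus ` {0<..<1} = {-1<..<(0::real)}"
    by (auto simp: image_iff intro!: bexI[of _ "- _"])
  then have A: "has_set_integral (weighted_gain \<alpha> \<beta>) (- tail_sum (bcoeff \<beta>) \<alpha>) {-1<..<0}"
    using weighted_gain_left[OF \<alpha> \<beta>] has_set_integral_reflect[of "weighted_gain \<alpha> \<beta>" "{0<..<1}" "{-1<..<0}"] by simp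
  have "uminus ` {1<..} = {..<(-1::real)}"
    by (auto simp: image_iff intro!: bexI[of _ "- _"])
  then have B: "has_set_integral (weighted_gain \<alpha> \<beta>) (1 / \<alpha> - Beta (\<alpha> + \<beta>) (1 - \<beta>)) {..<-1}"
    using inverted_gain_left[OF \<alpha> \<beta>] has_set_integral_reflect[of "weighted_gain \<alpha> \<beta>" "{1<..}" "{..<-1}"]
      has_set_integral_invert[of "\<lambda>t. weighted_gain \<alpha> \<beta> (- t)"] by simp
  have "has_set_integral (weighted_gain \<alpha> \<beta>)
      (\<beta> * Beta (\<alpha> + \<beta>) (1 - \<alpha>) / \<alpha> + (- tail_sum (bcoeff \<beta>) \<alpha> + (1 / \<alpha> - Beta (\<alpha> + \<beta>) (1 - \<beta>))))
      ({0<..} \<union> ({-1<..<0} \<union> {..<-1}))" (is "has_set_integral _ ?I ?S")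
    by (intro has_set_integral_disjoint_Un weighted_gain_right A B \<alpha> \<beta>) auto
  moreover have "?I = T_const \<alpha> \<beta> / \<alpha>"
    using \<alpha> \<beta> by (simp add: T_const_eq field_simps)
  moreover have "AE u in lborel. indicator ?S u * weighted_gain \<alpha> \<beta> u = weighted_gain \<alpha> \<beta> u"
    using AE_lborel_singleton[of "-1::real"] AE_lborel_singleton[of "0::real"]
    by eventually_elim (auto simp: indicator_def)
  ultimately show ?thesis
    by (subst has_bochner_integral_cong_AE[symmetric]) auto
qed

text \<open>
  The constant term 2 of the even series is a lower bound for its sum.
\<close>
lemma folded_gain_nonpos:
  assumes "0 < u" "u < 1"
  shows "weighted_gain \<alpha> \<beta> u + weighted_gain \<alpha> \<beta> (- u) \<le> 0"
proof -
  have "even_coeff \<beta> 0 * u ^ 0 \<le> (1 - u) powr (- \<beta>) + (1 + u) powr (- \<beta>)"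
    using sum_le_suminf[OF sums_summable[OF even_coeff_sums[OF \<beta>]], of u "{0}"] even_coeff_sums[OF \<beta>, of u]
      assms even_coeff_bounds[OF \<beta>] by (auto simp: sums_iff)
  then have "jump_gain \<beta> u + jump_gain \<beta> (- u) \<le> 0"
    using assms by (simp add: jump_gain_def even_coeff_def)
  then have "(jump_gain \<beta> u + jump_gain \<beta> (- u)) * u powr (- \<alpha> - 1) \<le> 0"
    by (intro mult_nonpos_nonneg) auto
  then show ?thesis using assms by (simp add: weighted_gain_def algebra_simps)
qed

lemma folded_gain_inner:
  "has_set_integral (\<lambda>u. weighted_gain \<alpha> \<beta> u + weighted_gain \<alpha> \<beta> (- u)) (- tail_sum (even_coeff \<beta>) \<alpha>) {0<..<1}"
proof -
  have "has_set_integral (\<lambda>t. ((1 - t) powr (- \<beta>) + (1 + t) powr (- \<beta>) - 2) / t * t powr ((1 - \<alpha>) - 1)) (tail_sum (even_coeff \<beta>) \<alpha>) {0<..<1}"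
  proof (subst has_set_integral_power_series[where d = "\<lambda>n. even_coeff \<beta> (Suc n)", symmetric])
    fix t :: real assume t: "0 < t" "t < 1"
    have "(\<lambda>n. even_coeff \<beta> (Suc n) * t ^ Suc n) sums ((1 - t) powr (- \<beta>) + (1 + t) powr (- \<beta>) - 2)"
      using even_coeff_sums[OF \<beta>, of t] t by (subst sums_Suc_iff) (auto simp: even_coeff_def)
    from sums_divide[OF this, of t] t
    show "(\<lambda>n. even_coeff \<beta> (Suc n) * t ^ n) sums (((1 - t) powr (- \<beta>) + (1 + t) powr (- \<beta>) - 2) / t)" by simp
  next
    show "(\<lambda>n. even_coeff \<beta> (Suc n) / (real n + (1 - \<alpha>))) sums tail_sum (even_coeff \<beta>) \<alpha>"
      unfolding tail_sum_def using \<alpha> by (intro summable_sums summable_tail_even_coeff[OF \<beta>]) auto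
  qed (use \<alpha> even_coeff_bounds[OF \<beta>] in auto)
  from has_bochner_integral_minus[OF this] show ?thesis
  proof (rule has_bochner_integral_cong[THEN iffD1, rotated 3])
    fix t :: real
    show "- (indicator {0<..<1} t * (((1 - t) powr - \<beta> + (1 + t) powr - \<beta> - 2) / t * t powr (1 - \<alpha> - 1)))
      = indicator {0<..<1} t * (weighted_gain \<alpha> \<beta> t + weighted_gain \<alpha> \<beta> (- t))"
      by (auto simp: indicator_def weighted_gain_def jump_gain_def powr_diff powr_minus field_simps)
  qed auto
qed

lemma folded_gain_outer:
  "has_set_integral (\<lambda>u. weighted_gain \<alpha> \<beta> u + weighted_gain \<alpha> \<beta> (- u)) (2 / \<alpha> - full_sum (even_coeff \<beta>) (\<alpha> + \<beta>)) {1<..}"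
proof -
  have "((\<lambda>t. t powr (\<alpha> - 1)) has_integral (1 powr (\<alpha> - 1 + 1) / (\<alpha> - 1 + 1))) {0..1}"
    using \<alpha> by (intro has_integral_powr_from_0) auto
  from has_integral_mult_right[OF this, of 2]
  have A: "has_set_integral (\<lambda>t. 2 * t powr (\<alpha> - 1)) (2 / \<alpha>) {0<..<1}"
    by (intro has_set_integral_nonneg) (auto simp: has_integral_Icc_iff_Ioo)
  have "has_set_integral (\<lambda>t. ((1 - t) powr (- \<beta>) + (1 + t) powr (- \<beta>)) * t powr (\<alpha> + \<beta> - 1)) (full_sum (even_coeff \<beta>) (\<alpha> + \<beta>)) {0<..<1}"
    by (subst has_set_integral_power_series[where d = "even_coeff \<beta>", symmetric])
      (use \<alpha> \<beta> even_coeff_bounds[OF \<beta>] in \<open>auto intro!: even_coeff_sums[OF \<beta>] summable_sums summable_full_even_coeff[OF \<beta>] simp: full_sum_def\<close>)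
  from has_bochner_integral_diff[OF A this]
  have "has_set_integral (\<lambda>t. (weighted_gain \<alpha> \<beta> (1 / t) + weighted_gain \<alpha> \<beta> (- (1 / t))) / t\<^sup>2) (2 / \<alpha> - full_sum (even_coeff \<beta>) (\<alpha> + \<beta>)) {0<..<1}"
  proof (rule has_bochner_integral_cong[THEN iffD1, rotated 3])
    fix t :: real
    show "indicator {0<..<1} t * (2 * t powr (\<alpha> - 1)) -
       indicator {0<..<1} t * (((1 - t) powr - \<beta> + (1 + t) powr - \<beta>) * t powr (\<alpha> + \<beta> - 1))
       = indicator {0<..<1} t * ((weighted_gain \<alpha> \<beta> (1 / t) + weighted_gain \<alpha> \<beta> (- (1 / t))) / t\<^sup>2)"
    proof (cases "t \<in> {0<..<1}")
      case True
      then have "\<bar>1 - 1 / t\<bar> = (1 - t) / t" "1 + 1 / t = (1 + t) / t" by (simp_all add: field_simps abs_if)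
      then show ?thesis
        using True by (simp add: weighted_gain_def jump_gain_def powr_divide powr_diff powr_add powr_minus power2_eq_square field_simps)
    qed auto
  qed auto
  then show ?thesis
    by (subst has_set_integral_invert) auto
qed

text \<open>
  Folding pairs the jumps \<open>u\<close> and \<open>- u\<close>.  The contribution of \<open>u > 0\<close> alone expands with
  alternating signs; in the folded series all coefficients are nonnegative.
\<close>
proposition T_const_series:
  "T_const \<alpha> \<beta> = 2 - \<alpha> * (tail_sum (even_coeff \<beta>) \<alpha> + full_sum (even_coeff \<beta>) (\<alpha> + \<beta>))"
proof -
  let ?F = "\<lambda>u. weighted_gain \<alpha> \<beta> u + weighted_gain \<alpha> \<beta> (- u)"
  have "has_set_integral ?F (- tail_sum (even_coeff \<beta>) \<alpha> + (2 / \<alpha> - full_sum (even_coeff \<beta>) (\<alpha> + \<beta>))) ({0<..<1} \<union> {1<..})"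
    by (intro has_set_integral_disjoint_Un folded_gain_inner folded_gain_outer) auto
  moreover have "AE u in lborel. indicator ({0<..<1} \<union> {1<..}) u * ?F u = indicator {0<..} u * ?F u"
    using AE_lborel_singleton[of "1::real"]
    by eventually_elim (auto simp: indicator_def)
  ultimately have "has_set_integral ?F (- tail_sum (even_coeff \<beta>) \<alpha> + (2 / \<alpha> - full_sum (even_coeff \<beta>) (\<alpha> + \<beta>))) {0<..}"
    by (subst has_bochner_integral_cong_AE[symmetric, where f = "\<lambda>u. indicator ({0<..<1} \<union> {1<..}) u * ?F u"]) auto
  moreover have "has_set_integral ?F (T_const \<alpha> \<beta> / \<alpha>) {0<..}"
    by (intro has_set_integral_fold integral_weighted_gain) auto
  ultimately have "T_const \<alpha> \<beta> / \<alpha> = - tail_sum (even_coeff \<beta>) \<alpha> + (2 / \<alpha> - full_sum (even_coeff \<beta>) (\<alpha> + \<beta>))"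
    by (rule has_bochner_integral_eq[symmetric])
  then show ?thesis using \<alpha> by (simp add: field_simps)
qed

end

section \<open>Dependence of the constant on the tail index\<close>

text \<open>
  Termwise, because \<open>a / (n + 1 - a)\<close> increases in \<open>a\<close>.
\<close>
lemma mult_tail_sum_mono:
  assumes "\<And>n. 0 \<le> d n" "\<And>a. a < 1 \<Longrightarrow> summable (\<lambda>n. d (Suc n) / (real n + (1 - a)))"
    and "0 \<le> a" "a \<le> b" "b < 1"
  shows "a * tail_sum d a \<le> b * tail_sum d b"
proof -
  have "a * (d (Suc n) / (real n + (1 - a))) \<le> b * (d (Suc n) / (real n + (1 - b)))" for n
    using assms by (intro mult_mono divide_left_mono) auto
  then show ?thesis
    unfolding tail_sum_def using assms
    by (subst (1 2) suminf_mult[symmetric]) (auto intro!: suminf_le summable_mult simp del: times_divide_eq_right)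
qed

text \<open>
  Termwise, because \<open>a / (n + a + \<beta>)\<close> increases in \<open>a\<close>.
\<close>
lemma mult_full_sum_mono:
  assumes "\<And>n. 0 \<le> d n" "\<And>\<gamma>. 0 < \<gamma> \<Longrightarrow> summable (\<lambda>n. d n / (real n + \<gamma>))"
    and "0 \<le> a" "a \<le> b" "0 < \<beta>"
  shows "a * full_sum d (a + \<beta>) \<le> b * full_sum d (b + \<beta>)"
proof -
  have "a * (d n / (real n + (a + \<beta>))) \<le> b * (d n / (real n + (b + \<beta>)))" for n
  proof -
    have "a / (real n + (a + \<beta>)) \<le> b / (real n + (b + \<beta>))"
    proof (rule frac_le_eq[THEN iffD2])
      have "a * (real n + (b + \<beta>)) - b * (real n + (a + \<beta>)) = (a - b) * (real n + \<beta>)"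
        by (simp add: algebra_simps)
      also have "\<dots> \<le> 0" using assms by (intro mult_nonpos_nonneg) auto
      finally show "(a * (real n + (b + \<beta>)) - b * (real n + (a + \<beta>))) / ((real n + (a + \<beta>)) * (real n + (b + \<beta>))) \<le> 0"
        using assms by (intro divide_nonpos_nonneg) auto
    qed (use assms in auto)
    from mult_left_mono[OF this assms(1)[of n]] show ?thesis by (simp add: mult.commute)
  qed
  then show ?thesis
    unfolding full_sum_def using assms
    by (subst (1 2) suminf_mult[symmetric]) (auto intro!: suminf_le summable_mult simp del: times_divide_eq_right)
qed

lemma T_const_antimono:
  assumes "0 < \<beta>" "\<beta> < 1" "0 < a" "a \<le> b" "b < 1"
  shows "T_const b \<beta> \<le> T_const a \<beta>"
  using assms mult_tail_sum_mono[of "even_coeff \<beta>" a b] mult_full_sum_mono[of "even_coeff \<beta>" a b \<beta>]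
  by (simp add: T_const_series even_coeff_bounds summable_full_even_coeff summable_tail_even_coeff distrib_left add_mono)

lemma T_const_0:
  assumes "0 < \<beta>" "\<beta> < 1"
  shows "T_const 0 \<beta> = 2"
proof -
  have "\<beta> \<notin> \<int>\<^sub>\<le>\<^sub>0" using assms by (auto elim!: nonpos_Ints_cases)
  then have "\<beta> * Beta \<beta> 1 = 1"
    using assms Gamma_plus1[of \<beta>] Gamma_real_pos[of \<beta>] by (simp add: Beta_def Gamma_eq_zero_iff)
  then show ?thesis using assms by (simp add: T_const_eq)
qed

text \<open>
  In the series for \<open>T_const b \<beta>\<close> with \<open>b > a\<close>, the first sum is at most \<open>(1 - a) / (1 - b)\<close>
  times its value at \<open>a\<close>, since \<open>(1 - b) / (n + 1 - b)\<close> decreases in \<open>b\<close>, and the second sum is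
  at most its value at \<open>a\<close>.  The resulting lower bound is continuous in \<open>b\<close> and exact at
  \<open>b = a\<close>.
\<close>
lemma T_const_lower_semicontinuous_right:
  assumes \<beta>: "0 < \<beta>" "\<beta> < 1" and a: "0 \<le> a" "a < 1" and "0 < \<epsilon>"
  shows "\<exists>b. a < b \<and> b < 1 \<and> T_const a \<beta> - \<epsilon> < T_const b \<beta>"
proof -
  let ?A = "tail_sum (even_coeff \<beta>) a" and ?B = "full_sum (even_coeff \<beta>) (a + \<beta>)"
  define r where "r b = 2 - b * ((1 - a) / (1 - b) * ?A + ?B)" for b
  have Ta: "T_const a \<beta> = r a"
    using T_const_series[of a \<beta>] T_const_0[OF \<beta>] assms by (cases "a = 0") (auto simp: r_def)
  have le: "r b \<le> T_const b \<beta>" if b: "a < b" "b < 1" for b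
  proof -
    have "tail_sum (even_coeff \<beta>) b \<le> (1 - a) / (1 - b) * ?A"
    proof -
      have "even_coeff \<beta> (Suc n) / (real n + (1 - b)) \<le> (1 - a) / (1 - b) * (even_coeff \<beta> (Suc n) / (real n + (1 - a)))" for n
      proof -
        have "real n * b \<ge> real n * a" using b by (intro mult_left_mono) auto
        then have "(1 - b) * (real n + (1 - a)) \<le> (1 - a) * (real n + (1 - b))"
          by (simp add: algebra_simps)
        then have "1 / (real n + (1 - b)) \<le> (1 - a) / (1 - b) * (1 / (real n + (1 - a)))"
          using a b by (simp add: divide_simps)
        from mult_left_mono[OF this even_coeff_bounds(1)[OF \<beta>, of "Suc n"]]
        show ?thesis by (simp add: algebra_simps)
      qed
      then show ?thesis
        unfolding tail_sum_def using a b
        by (subst suminf_mult[symmetric]) (auto intro!: suminf_le summable_mult summable_tail_even_coeff[OF \<beta>] simp del: times_divide_eq_right times_divide_times_eq)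
    qed
    moreover have "full_sum (even_coeff \<beta>) (b + \<beta>) \<le> ?B"
      unfolding full_sum_def using a b \<beta>
      by (intro suminf_le summable_full_even_coeff divide_left_mono even_coeff_bounds) auto
    ultimately have "b * (tail_sum (even_coeff \<beta>) b + full_sum (even_coeff \<beta>) (b + \<beta>)) \<le> b * ((1 - a) / (1 - b) * ?A + ?B)"
      using a b by (intro mult_left_mono add_mono) auto
    then show ?thesis
      using T_const_series[of b \<beta>] \<beta> a b by (simp add: r_def)
  qed
  have "(r \<longlongrightarrow> r a) (at_right a)"
    unfolding r_def using a by (intro tendsto_intros) auto
  then have "eventually (\<lambda>b. r a - \<epsilon> < r b) (at_right a)"
    using \<open>0 < \<epsilon>\<close> by (intro order_tendstoD(1)) auto
  moreover have "eventually (\<lambda>b. b \<in> {a<..<1}) (at_right a)"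
    using a by (intro eventually_at_right_real) auto
  ultimately have "eventually (\<lambda>b. a < b \<and> b < 1 \<and> T_const a \<beta> - \<epsilon> < T_const b \<beta>) (at_right a)"
    by eventually_elim (use le Ta in force)
  then show ?thesis using trivial_limit_at_right_real eventually_happens' by blast
qed

text \<open>
  A bound for \<open>\<alpha>\<close> times the integral of \<open>\<bar>weighted_gain \<alpha> \<beta>\<bar>\<close> that holds for all
  \<open>\<alpha> \<le> a\<close> at once.
\<close>
definition gain_bound :: "real \<Rightarrow> real \<Rightarrow> real" where
  "gain_bound a \<beta> = 2 + 2 * (a * tail_sum (bcoeff \<beta>) a + a * Beta (a + \<beta>) (1 - \<beta>))"

lemma has_set_integral_Beta_outer:
  assumes "0 < \<alpha>" "\<alpha> < 1" "0 < \<beta>" "\<beta> < 1"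
  shows "has_set_integral (\<lambda>u. (u - 1) powr (- \<beta>) * u powr (- \<alpha> - 1)) (Beta (\<alpha> + \<beta>) (1 - \<beta>)) {1<..}"
proof (subst has_set_integral_invert)
  show "has_set_integral (\<lambda>t. (1 / t - 1) powr - \<beta> * (1 / t) powr (- \<alpha> - 1) / t\<^sup>2) (Beta (\<alpha> + \<beta>) (1 - \<beta>)) {0<..<1}"
  proof (rule has_bochner_integral_cong[THEN iffD1, rotated 3, OF has_set_integral_Beta(1)])
    fix t :: real
    show "indicator {0<..<1} t * (t powr (\<alpha> + \<beta> - 1) * (1 - t) powr (1 - \<beta> - 1)) =
      indicator {0<..<1} t * ((1 / t - 1) powr - \<beta> * (1 / t) powr (- \<alpha> - 1) / t\<^sup>2)"
    proof (cases "t \<in> {0<..<1}")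
      case True
      then have "1 / t - 1 = (1 - t) / t" by (simp add: field_simps)
      then show ?thesis
        using True by (simp add: powr_divide powr_diff powr_add powr_minus power2_eq_square field_simps)
    qed auto
  qed (use assms in auto)
qed auto

text \<open>
  Almost everywhere the absolute value is at most \<open>weighted_gain \<alpha> \<beta> u + 2 * N (- u)\<close>, where \<open>N (- u)\<close> dominates
  the negative part of the gain and is supported in \<open>u < 0\<close>.  The first summand integrates to
  \<open>T_const \<alpha> \<beta> / \<alpha>\<close>, which is at most \<open>2 / \<alpha>\<close>; the integral of the second is a sum of two
  series whose product with \<open>\<alpha>\<close> increases in \<open>\<alpha>\<close>.
\<close>
lemma integral_abs_weighted_gain_le:
  assumes \<alpha>: "0 < \<alpha>" "\<alpha> \<le> a" "a < 1" and \<beta>: "0 < \<beta>" "\<beta> < 1"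
  shows "\<alpha> * (LBINT u. \<bar>weighted_gain \<alpha> \<beta> u\<bar>) \<le> gain_bound a \<beta>"
proof -
  define N where "N u = indicator {0<..<1} u * (- weighted_gain \<alpha> \<beta> (- u))
     + indicator {1<..} u * ((u - 1) powr (- \<beta>) * u powr (- \<alpha> - 1))" for u
  let ?J = "tail_sum (bcoeff \<beta>) \<alpha> + Beta (\<alpha> + \<beta>) (1 - \<beta>)"
  have "has_set_integral (\<lambda>t. - weighted_gain \<alpha> \<beta> (- t)) (tail_sum (bcoeff \<beta>) \<alpha>) {0<..<1}"
    using has_bochner_integral_minus[OF weighted_gain_left, of \<alpha> \<beta>] \<alpha> \<beta> by simp
  from has_bochner_integral_add[OF this has_set_integral_Beta_outer[of \<alpha> \<beta>]] \<alpha> \<beta>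
  have N: "has_bochner_integral lborel N ?J" by (simp add: N_def[abs_def])
  then have N': "integrable lborel (\<lambda>u. N (- u))" "(LBINT u. N (- u)) = ?J"
    using lborel_integrable_real_affine[of N "-1" 0] lborel_integral_real_affine[of "-1" N 0]
    by (auto simp: has_bochner_integral_iff)
  have Q: "integrable lborel (weighted_gain \<alpha> \<beta>)" "(LBINT u. weighted_gain \<alpha> \<beta> u) = T_const \<alpha> \<beta> / \<alpha>"
    using integral_weighted_gain[of \<alpha> \<beta>] \<alpha> \<beta> by (auto simp: has_bochner_integral_iff)
  have le: "\<bar>weighted_gain \<alpha> \<beta> u\<bar> \<le> weighted_gain \<alpha> \<beta> u + 2 * N (- u)" if u: "u \<noteq> - 1" for u
  proof -
    consider "0 < u" | "u = 0" | "- 1 < u" "u < 0" | "u < - 1" using u by linarith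
    then show ?thesis
    proof cases
      case 1
      then have "(1 + u) powr (- \<beta>) \<le> (1 + u) powr 0" using \<beta> by (intro powr_mono) auto
      then have "0 \<le> weighted_gain \<alpha> \<beta> u" using 1 by (simp add: weighted_gain_def jump_gain_def)
      then show ?thesis using 1 by (simp add: N_def)
    next
      case 2
      then show ?thesis by (simp add: N_def weighted_gain_def)
    next
      case 3
      then have "(1 + u) powr (- 0) \<le> (1 + u) powr (- \<beta>)" using \<beta> by (intro powr_mono') auto
      then have "weighted_gain \<alpha> \<beta> u \<le> 0" using 3
        by (auto simp: weighted_gain_def jump_gain_def intro!: mult_nonpos_nonneg)
      then show ?thesis using 3 by (simp add: N_def)
    next
      case 4
      then have abs: "\<bar>1 + u\<bar> = - u - 1" "\<bar>u\<bar> = - u" by auto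
      have "\<bar>weighted_gain \<alpha> \<beta> u\<bar> = \<bar>1 - (- u - 1) powr (- \<beta>)\<bar> * (- u) powr (- \<alpha> - 1)"
        by (simp add: weighted_gain_def jump_gain_def abs_mult abs)
      also have "\<dots> \<le> (1 + (- u - 1) powr (- \<beta>)) * (- u) powr (- \<alpha> - 1)"
        by (intro mult_right_mono order_trans[OF abs_triangle_ineq4]) auto
      also have "\<dots> = weighted_gain \<alpha> \<beta> u + 2 * N (- u)"
        using 4 by (simp add: N_def weighted_gain_def jump_gain_def abs algebra_simps)
      finally show ?thesis .
    qed
  qed
  have "(LBINT u. \<bar>weighted_gain \<alpha> \<beta> u\<bar>) \<le> (LBINT u. weighted_gain \<alpha> \<beta> u + 2 * N (- u))"
  proof (rule integral_mono_AE)
    show "AE u in lborel. \<bar>weighted_gain \<alpha> \<beta> u\<bar> \<le> weighted_gain \<alpha> \<beta> u + 2 * N (- u)"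
      using AE_lborel_singleton[of "-1::real"] by eventually_elim (rule le)
  qed (use Q N' in auto)
  also have "\<dots> = T_const \<alpha> \<beta> / \<alpha> + 2 * ?J" using Q N' by simp
  finally have "\<alpha> * (LBINT u. \<bar>weighted_gain \<alpha> \<beta> u\<bar>) \<le> \<alpha> * (T_const \<alpha> \<beta> / \<alpha> + 2 * ?J)"
    using \<alpha> by (intro mult_left_mono) auto
  also have "\<dots> = T_const \<alpha> \<beta> + 2 * (\<alpha> * tail_sum (bcoeff \<beta>) \<alpha> + \<alpha> * full_sum (bcoeff \<beta>) (\<alpha> + \<beta>))"
    using \<alpha> \<beta> by (simp add: full_sum_bcoeff algebra_simps)
  also have "\<dots> \<le> 2 + 2 * (a * tail_sum (bcoeff \<beta>) a + a * full_sum (bcoeff \<beta>) (a + \<beta>))"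
  proof (intro add_mono mult_left_mono)
    have "0 \<le> tail_sum (even_coeff \<beta>) \<alpha>" "0 \<le> full_sum (even_coeff \<beta>) (\<alpha> + \<beta>)"
      unfolding tail_sum_def full_sum_def using \<alpha> \<beta>
      by (auto intro!: suminf_nonneg summable_tail_even_coeff summable_full_even_coeff divide_nonneg_nonneg even_coeff_bounds)
    then show "T_const \<alpha> \<beta> \<le> 2" using \<alpha> \<beta> by (simp add: T_const_series)
    show "\<alpha> * tail_sum (bcoeff \<beta>) \<alpha> \<le> a * tail_sum (bcoeff \<beta>) a"
      using \<alpha> \<beta> by (intro mult_tail_sum_mono bcoeff_nonneg summable_bcoeff_Suc) auto
    show "\<alpha> * full_sum (bcoeff \<beta>) (\<alpha> + \<beta>) \<le> a * full_sum (bcoeff \<beta>) (a + \<beta>)"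
      using \<alpha> \<beta> bcoeff_sums_Beta by (intro mult_full_sum_mono bcoeff_nonneg) (auto simp: sums_iff)
  qed auto
  finally show ?thesis using \<alpha> \<beta> by (simp add: gain_bound_def full_sum_bcoeff)
qed

lemma integral_weighted_gain_central_nonpos:
  assumes "0 < \<alpha>" "\<alpha> < 1" "0 < \<beta>" "\<beta> < 1" "\<rho> < 1"
  shows "(LBINT u. indicator {-\<rho>..\<rho>} u * weighted_gain \<alpha> \<beta> u) \<le> 0"
proof -
  let ?f = "\<lambda>u. indicator {-\<rho>..\<rho>} u * weighted_gain \<alpha> \<beta> u"
  have "integrable lborel ?f"
    using integrable_mult_indicator[of "{-\<rho>..\<rho>}" lborel "weighted_gain \<alpha> \<beta>"] integral_weighted_gain[of \<alpha> \<beta>] assms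
    by (simp add: has_bochner_integral_iff)
  then have "has_set_integral (\<lambda>u. ?f u + ?f (- u)) (LBINT u. ?f u) {0<..}"
    by (intro has_set_integral_fold) (auto simp: has_bochner_integral_iff)
  then have "(LBINT u. ?f u) = (LBINT u. indicator {0<..} u * (?f u + ?f (- u)))"
    by (simp add: has_bochner_integral_iff)
  also have "\<dots> = - (LBINT u. - (indicator {0<..} u * (?f u + ?f (- u))))" by simp
  also have "\<dots> \<le> 0"
    using folded_gain_nonpos[of \<alpha> \<beta>] assms
    by (auto intro!: Bochner_Integration.integral_nonneg simp: indicator_def simp del: Bochner_Integration.integral_minus)
  finally show ?thesis .
qed

text \<open>
  The form in which the constant enters the drift: jumps below the relative size \<open>\<rho>\<close> are left
  out of the gain, which can only increase it, and \<open>\<eta>\<close> is the relative error of the jump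
  density.
\<close>
proposition truncated_gain_ge:
  assumes \<alpha>: "0 < \<alpha>" "\<alpha> \<le> a" "a < 1" and \<beta>: "0 < \<beta>" "\<beta> < 1" and "\<rho> < 1" "0 \<le> \<eta>"
  shows "T_const a \<beta> - \<eta> * gain_bound a \<beta>
    \<le> \<alpha> * (LBINT u. indicator (- {-\<rho>..\<rho>}) u * weighted_gain \<alpha> \<beta> u - \<eta> * \<bar>weighted_gain \<alpha> \<beta> u\<bar>)"
proof -
  let ?Q = "weighted_gain \<alpha> \<beta>"
  have Q: "integrable lborel ?Q" "(LBINT u. ?Q u) = T_const \<alpha> \<beta> / \<alpha>"
    using integral_weighted_gain[of \<alpha> \<beta>] \<alpha> \<beta> by (auto simp: has_bochner_integral_iff)
  have i: "integrable lborel (\<lambda>u. indicator {-\<rho>..\<rho>} u * ?Q u)" "integrable lborel (\<lambda>u. indicator (- {-\<rho>..\<rho>}) u * ?Q u)"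
    using integrable_mult_indicator[OF _ Q(1), of "{-\<rho>..\<rho>}"] integrable_mult_indicator[OF _ Q(1), of "- {-\<rho>..\<rho>}"] by auto
  have "(LBINT u. ?Q u) = (LBINT u. indicator {-\<rho>..\<rho>} u * ?Q u + indicator (- {-\<rho>..\<rho>}) u * ?Q u)"
    by (intro Bochner_Integration.integral_cong) (auto simp: indicator_def)
  also have "\<dots> \<le> (LBINT u. indicator (- {-\<rho>..\<rho>}) u * ?Q u)"
    using integral_weighted_gain_central_nonpos[of \<alpha> \<beta> \<rho>] i assms by simp
  finally have "T_const \<alpha> \<beta> \<le> \<alpha> * (LBINT u. indicator (- {-\<rho>..\<rho>}) u * ?Q u)"
    using Q \<alpha> by (simp add: divide_le_eq mult.commute)
  moreover have "\<eta> * (\<alpha> * (LBINT u. \<bar>?Q u\<bar>)) \<le> \<eta> * gain_bound a \<beta>"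
    using assms by (intro mult_left_mono integral_abs_weighted_gain_le) auto
  moreover have "T_const a \<beta> \<le> T_const \<alpha> \<beta>"
    using assms by (intro T_const_antimono) auto
  moreover have "\<alpha> * (LBINT u. indicator (- {-\<rho>..\<rho>}) u * ?Q u - \<eta> * \<bar>?Q u\<bar>)
      = \<alpha> * (LBINT u. indicator (- {-\<rho>..\<rho>}) u * ?Q u) - \<eta> * (\<alpha> * (LBINT u. \<bar>?Q u\<bar>))"
    using i Q by (simp add: algebra_simps)
  ultimately show ?thesis by linarith
qed

section \<open>Transience of Markov chains\<close>

text \<open>
  Integrating the Markov property removes the conditional expectation.
\<close>
lemma hit_prob_Suc:
  assumes "markov_chain P X K" and B: "B \<in> sets borel"
  shows "hit_prob P X (Suc n) x B = (\<integral>\<^sup>+\<omega>. emeasure (K (X n \<omega>)) B \<partial>P x)"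
proof -
  have K: "K \<in> borel \<rightarrow>\<^sub>M prob_algebra borel" and "prob_space (P x)"
    and X: "\<And>n. X n \<in> borel_measurable (P x)"
    and ce: "AE \<omega> in P x. real_cond_exp (P x) (history (P x) X n) (\<lambda>\<omega>. indicator B (X (Suc n) \<omega>)) \<omega>
               = measure (K (X n \<omega>)) B"
    using assms by (auto simp: markov_chain_def)
  interpret prob_space "P x" by fact
  note X[measurable] B[measurable]
  have [measurable]: "(\<lambda>y. measure (K y) B) \<in> borel_measurable borel"
    using measurable_compose[OF K[THEN measurable_prob_algebraD] measurable_measure_subprob_algebra[OF B]] .
  have prob: "prob_space (K y)" for y
    using measurable_space[OF K, of y] by (auto simp: space_prob_algebra)
  have "sets (history (P x) X n) \<subseteq> sets (P x)"
    unfolding history_def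
    by (subst sets_measure_of) (auto intro!: sets.sigma_sets_subset measurable_sets)
  then interpret finite_measure_subalgebra "P x" "history (P x) X n"
    by unfold_locales (auto simp: subalgebra_def history_def space_measure_of_conv)
  let ?I = "\<lambda>\<omega>. indicator B (X (Suc n) \<omega>) :: real"
  have int: "integrable (P x) ?I"
    by (intro integrable_const_bound[where B = 1]) auto
  have "(\<integral>\<omega>. measure (K (X n \<omega>)) B \<partial>P x) = (\<integral>\<omega>. real_cond_exp (P x) (history (P x) X n) ?I \<omega> \<partial>P x)"
    using ce by (intro integral_cong_AE) (auto elim!: eventually_mono)
  also have "\<dots> = (\<integral>\<omega>. ?I \<omega> \<partial>P x)" by (rule real_cond_exp_int(2)[OF int])
  also have "\<dots> = measure (P x) {\<omega> \<in> space (P x). X (Suc n) \<omega> \<in> B}"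
  proof -
    have "(\<integral>\<omega>. ?I \<omega> \<partial>P x) = (\<integral>\<omega>. indicator {\<omega> \<in> space (P x). X (Suc n) \<omega> \<in> B} \<omega> \<partial>P x)"
      by (intro Bochner_Integration.integral_cong) (auto simp: indicator_def)
    then show ?thesis by simp
  qed
  finally have "measure (P x) {\<omega> \<in> space (P x). X (Suc n) \<omega> \<in> B} = (\<integral>\<omega>. measure (K (X n \<omega>)) B \<partial>P x)" ..
  moreover have "(\<integral>\<^sup>+\<omega>. emeasure (K (X n \<omega>)) B \<partial>P x) = ennreal (\<integral>\<omega>. measure (K (X n \<omega>)) B \<partial>P x)"
  proof -
    have "(\<integral>\<^sup>+\<omega>. emeasure (K (X n \<omega>)) B \<partial>P x) = (\<integral>\<^sup>+\<omega>. ennreal (measure (K (X n \<omega>)) B) \<partial>P x)"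
      using prob by (intro nn_integral_cong) (simp add: finite_measure.emeasure_eq_measure prob_space.finite_measure)
    also have "\<dots> = ennreal (\<integral>\<omega>. measure (K (X n \<omega>)) B \<partial>P x)"
      using prob by (intro nn_integral_eq_integral integrable_const_bound[where B = 1]) (auto simp: prob_space.prob_le_1)
    finally show ?thesis .
  qed
  ultimately show ?thesis by (simp add: hit_prob_def emeasure_eq_measure)
qed

lemma nn_integral_chain_Suc:
  assumes "markov_chain P X K" and [measurable]: "g \<in> borel_measurable borel"
  shows "(\<integral>\<^sup>+\<omega>. g (X (Suc n) \<omega>) \<partial>P x) = (\<integral>\<^sup>+\<omega>. (\<integral>\<^sup>+y. g y \<partial>K (X n \<omega>)) \<partial>P x)"
proof -
  have K: "K \<in> borel \<rightarrow>\<^sub>M subprob_algebra borel" and "prob_space (P x)"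
    and X: "\<And>n. X n \<in> borel_measurable (P x)"
    using assms by (auto simp: markov_chain_def intro: measurable_prob_algebraD)
  interpret prob_space "P x" by fact
  note X[measurable] K[measurable]
  have "distr (P x) borel (X (Suc n)) = distr (P x) borel (X n) \<bind> K"
  proof (rule measure_eqI)
    show "sets (distr (P x) borel (X (Suc n))) = sets (distr (P x) borel (X n) \<bind> K)"
      using sets_bind[of "distr (P x) borel (X n)" K borel] sets_kernel[OF K] by simp
    fix B assume "B \<in> sets (distr (P x) borel (X (Suc n)))"
    then have B[measurable]: "B \<in> sets borel" by simp
    have [measurable]: "(\<lambda>y. emeasure (K y) B) \<in> borel_measurable borel"
      using measurable_compose[OF K measurable_emeasure_subprob_algebra[OF B]] .
    have "emeasure (distr (P x) borel (X (Suc n))) B = hit_prob P X (Suc n) x B"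
      by (simp add: emeasure_distr hit_prob_def vimage_def Int_def conj_commute)
    also have "\<dots> = (\<integral>\<^sup>+y. emeasure (K y) B \<partial>distr (P x) borel (X n))"
      by (simp add: hit_prob_Suc[OF assms(1) B] nn_integral_distr)
    also have "\<dots> = emeasure (distr (P x) borel (X n) \<bind> K) B"
      by (rule emeasure_bind[symmetric, of _ _ borel]) (simp_all add: K)
    finally show "emeasure (distr (P x) borel (X (Suc n))) B = emeasure (distr (P x) borel (X n) \<bind> K) B" .
  qed
  then have "(\<integral>\<^sup>+y. g y \<partial>distr (P x) borel (X (Suc n))) = (\<integral>\<^sup>+y. g y \<partial>(distr (P x) borel (X n) \<bind> K))" by simp
  also have "\<dots> = (\<integral>\<^sup>+z. (\<integral>\<^sup>+y. g y \<partial>K z) \<partial>distr (P x) borel (X n))"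
    by (rule nn_integral_bind[of _ borel]) (simp_all add: K)
  also have "\<dots> = (\<integral>\<^sup>+\<omega>. (\<integral>\<^sup>+y. g y \<partial>K (X n \<omega>)) \<partial>P x)"
    using measurable_compose[OF K nn_integral_measurable_subprob_algebra[OF assms(2)]]
    by (intro nn_integral_distr) auto
  finally show ?thesis by (simp add: nn_integral_distr)
qed

text \<open>
  The mean of \<open>w\<close> along the chain never exceeds 1 and grows by at least \<open>\<epsilon>\<close> times the
  probability of being in \<open>B\<close>, so these probabilities sum to at most \<open>1 / \<epsilon>\<close>.
\<close>
lemma potential_le:
  fixes w :: "real \<Rightarrow> ennreal"
  assumes chain: "markov_chain P X K" and [measurable]: "w \<in> borel_measurable borel" "B \<in> sets borel"
    and w: "\<And>x. w x \<le> 1" and \<epsilon>: "0 < \<epsilon>"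
    and drift: "\<And>x. w x + ennreal \<epsilon> * indicator B x \<le> (\<integral>\<^sup>+y. w y \<partial>K x)"
  shows "(\<Sum>n. hit_prob P X n x B) \<le> ennreal (1 / \<epsilon>)"
proof -
  have "prob_space (P x)" and [measurable]: "\<And>n. X n \<in> borel_measurable (P x)"
    using chain by (auto simp: markov_chain_def)
  interpret prob_space "P x" by fact
  have "ennreal \<epsilon> * (\<Sum>n<N. hit_prob P X n x B) + (\<integral>\<^sup>+\<omega>. w (X 0 \<omega>) \<partial>P x) \<le> (\<integral>\<^sup>+\<omega>. w (X N \<omega>) \<partial>P x)" for N
  proof (induction N)
    case (Suc N)
    have "ennreal \<epsilon> * (\<Sum>n<Suc N. hit_prob P X n x B) + (\<integral>\<^sup>+\<omega>. w (X 0 \<omega>) \<partial>P x)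
        = (ennreal \<epsilon> * (\<Sum>n<N. hit_prob P X n x B) + (\<integral>\<^sup>+\<omega>. w (X 0 \<omega>) \<partial>P x)) + ennreal \<epsilon> * hit_prob P X N x B"
      by (simp add: distrib_left ac_simps)
    also have "\<dots> \<le> (\<integral>\<^sup>+\<omega>. w (X N \<omega>) \<partial>P x) + ennreal \<epsilon> * hit_prob P X N x B"
      by (intro add_right_mono Suc.IH)
    also have "hit_prob P X N x B = (\<integral>\<^sup>+\<omega>. indicator B (X N \<omega>) \<partial>P x)"
      unfolding hit_prob_def by (subst nn_integral_indicator[symmetric]) (auto simp: indicator_def intro!: nn_integral_cong simp del: nn_integral_indicator)
    also have "(\<integral>\<^sup>+\<omega>. w (X N \<omega>) \<partial>P x) + ennreal \<epsilon> * \<dots> = (\<integral>\<^sup>+\<omega>. w (X N \<omega>) + ennreal \<epsilon> * indicator B (X N \<omega>) \<partial>P x)"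
      by (simp add: nn_integral_add nn_integral_cmult)
    also have "\<dots> \<le> (\<integral>\<^sup>+\<omega>. (\<integral>\<^sup>+y. w y \<partial>K (X N \<omega>)) \<partial>P x)"
      by (intro nn_integral_mono drift)
    also have "\<dots> = (\<integral>\<^sup>+\<omega>. w (X (Suc N) \<omega>) \<partial>P x)"
      by (rule nn_integral_chain_Suc[OF chain assms(2), symmetric])
    finally show ?case .
  qed simp
  moreover have "(\<integral>\<^sup>+\<omega>. w (X N \<omega>) \<partial>P x) \<le> 1" for N
    using nn_integral_mono[of "P x" "\<lambda>\<omega>. w (X N \<omega>)" "\<lambda>_. 1"] w by (simp add: emeasure_space_1)
  ultimately have le1: "ennreal \<epsilon> * (\<Sum>n<N. hit_prob P X n x B) + (\<integral>\<^sup>+\<omega>. w (X 0 \<omega>) \<partial>P x) \<le> 1" for N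
    by (rule order_trans)
  have bound: "ennreal \<epsilon> * (\<Sum>n<N. hit_prob P X n x B) \<le> 1" for N
    by (rule order_trans[OF _ le1[of N]]) simp
  have "(\<Sum>n<N. hit_prob P X n x B) \<le> ennreal (1 / \<epsilon>)" for N
  proof -
    have "ennreal (1 / \<epsilon>) * (ennreal \<epsilon> * (\<Sum>n<N. hit_prob P X n x B)) \<le> ennreal (1 / \<epsilon>) * 1"
      by (intro mult_left_mono bound) auto
    moreover have "ennreal (1 / \<epsilon>) * ennreal \<epsilon> = 1"
      using \<epsilon> by (simp add: ennreal_mult[symmetric])
    ultimately show ?thesis by (simp add: mult.assoc[symmetric])
  qed
  then show ?thesis by (intro suminf_le_const) auto
qed

text \<open>
  The cover is adapted to \<open>w\<close>: its sets \<open>B j\<close> collect the points from which one step raises the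
  mean of \<open>w\<close> by at least \<open>1 / (j + 1)\<close>, and strictness of the drift at every point makes them
  exhaust the line.
\<close>
proposition transient_if_bounded_strictly_subharmonic:
  fixes w :: "real \<Rightarrow> real"
  assumes chain: "markov_chain P X K" and irr: "phi_irreducible P X"
    and [measurable]: "w \<in> borel_measurable borel" and w: "\<And>x. 0 \<le> w x" "\<And>x. w x \<le> 1"
    and drift: "\<And>x. w x < (\<integral>y. w y \<partial>K x)"
  shows "transient P X"
proof -
  define B where "B j = {x. w x + 1 / real (Suc j) \<le> (\<integral>y. w y \<partial>K x)}" for j
  have K: "K \<in> borel \<rightarrow>\<^sub>M prob_algebra borel"
    using chain by (auto simp: markov_chain_def)
  have Kp: "prob_space (K x)" for x
    using measurable_space[OF K, of x] by (auto simp: space_prob_algebra)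
  have Ks: "sets (K x) = sets borel" for x
    by (rule sets_kernel[OF K[THEN measurable_prob_algebraD]]) simp
  have nn: "(\<integral>\<^sup>+y. ennreal (w y) \<partial>K x) = ennreal (\<integral>y. w y \<partial>K x)" for x
  proof -
    interpret prob_space "K x" by (rule Kp)
    have "integrable (K x) w"
    proof (rule integrable_const_bound[where B = 1])
      show "w \<in> borel_measurable (K x)"
        by (subst measurable_cong_sets[OF Ks refl]) (rule assms(3))
    qed (use w in simp)
    then show ?thesis using w by (intro nn_integral_eq_integral) auto
  qed
  have "(\<lambda>x. enn2real (\<integral>\<^sup>+y. ennreal (w y) \<partial>K x)) \<in> borel_measurable borel"
    using measurable_compose[OF K[THEN measurable_prob_algebraD] nn_integral_measurable_subprob_algebra, of "\<lambda>y. ennreal (w y)"]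
    by measurable
  moreover have "0 \<le> (\<integral>y. w y \<partial>K x)" for x
    using w by (intro Bochner_Integration.integral_nonneg)
  ultimately have [measurable]: "(\<lambda>x. \<integral>y. w y \<partial>K x) \<in> borel_measurable borel"
    by (simp add: nn)
  have B: "B j \<in> sets borel" for j
    unfolding B_def by measurable
  have cover: "(\<Union>j. B j) = UNIV"
  proof (intro equalityI subsetI UNIV_I)
    fix x :: real
    obtain j where "inverse (real (Suc j)) < (\<integral>y. w y \<partial>K x) - w x"
      using reals_Archimedean[of "(\<integral>y. w y \<partial>K x) - w x"] drift[of x] by auto
    then show "x \<in> (\<Union>j. B j)" by (auto simp: B_def inverse_eq_divide intro!: exI[of _ j])
  qed
  have "(\<Sum>n. hit_prob P X n x (B j)) \<le> ennreal (real (Suc j))" for j x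
  proof -
    have "ennreal (w x) + ennreal (1 / real (Suc j)) * indicator (B j) x \<le> (\<integral>\<^sup>+y. ennreal (w y) \<partial>K x)" for x
      using drift[of x] w
      by (auto simp: nn B_def indicator_def ennreal_plus[symmetric] simp del: ennreal_plus intro!: ennreal_leI)
    then have "(\<Sum>n. hit_prob P X n x (B j)) \<le> ennreal (1 / (1 / real (Suc j)))"
      using w B by (intro potential_le[OF chain, where w = "\<lambda>x. ennreal (w x)"]) auto
    then show ?thesis by simp
  qed
  then show ?thesis
    unfolding transient_def using irr B cover by (intro conjI exI[of _ B]) (auto intro!: exI[of _ "real (Suc _)"])
qed

lemma emeasure_jump_kernel_pos:
  assumes "f x \<in> borel_measurable borel" and [measurable]: "A \<in> sets borel" and "0 < emeasure lborel A"
    and pos: "\<And>y. y \<in> A \<Longrightarrow> 0 < f x (y - x)"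
  shows "0 < emeasure (jump_kernel f x) A"
proof (rule ccontr)
  note assms(1)[measurable]
  assume "\<not> ?thesis"
  then have "(\<integral>\<^sup>+y. ennreal (f x (y - x)) * indicator A y \<partial>lborel) = 0"
    by (simp add: jump_kernel_def emeasure_density)
  then have "AE y in lborel. ennreal (f x (y - x)) * indicator A y = 0"
    by (subst (asm) nn_integral_0_iff_AE) auto
  then have "AE y in lborel. y \<notin> A"
    by eventually_elim (use pos in \<open>force simp: indicator_def split: if_splits\<close>)
  then have "emeasure lborel A = 0" by (simp add: AE_iff_measurable[of A])
  then show False using assms by simp
qed

text \<open>
  Two jumps suffice: from \<open>x\<close> into \<open>[L, L + 1]\<close> far to the right, and from there, by a jump of
  length at least \<open>r\<close>, into any given part of \<open>[0, 1]\<close> of positive measure.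
\<close>
lemma phi_irreducible_jump_chain:
  assumes chain: "markov_chain P X (jump_kernel f)"
    and meas: "\<And>x. f x \<in> borel_measurable borel"
    and pos: "\<And>x. \<exists>r. \<forall>y\<ge>r. 0 < f x y"
    and far: "\<And>x y. r \<le> x \<Longrightarrow> r \<le> \<bar>y\<bar> \<Longrightarrow> 0 < f x y"
  shows "phi_irreducible P X"
  unfolding phi_irreducible_def
proof (intro exI[of _ "uniform_measure lborel {0..1}"] conjI allI)
  show "prob_space (uniform_measure lborel {0..1::real})"
    by (rule prob_space_uniform_measure) auto
next
  fix x
  show "\<exists>n\<ge>1. \<forall>B\<in>sets borel. 0 < emeasure (uniform_measure lborel {0..1}) B \<longrightarrow> 0 < hit_prob P X n x B"
  proof (intro exI[of _ 2] conjI ballI impI)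
    fix B :: "real set" assume B[measurable]: "B \<in> sets borel" and "0 < emeasure (uniform_measure lborel {0..1}) B"
    then have B01: "0 < emeasure lborel (B \<inter> {0..1})"
      by (simp add: Int_commute divide_ennreal_def)
    let ?K = "jump_kernel f"
    have K: "?K \<in> borel \<rightarrow>\<^sub>M prob_algebra borel" and "prob_space (P x)"
      and [measurable]: "\<And>n. X n \<in> borel_measurable (P x)" and X0: "AE \<omega> in P x. X 0 \<omega> = x"
      using chain by (auto simp: markov_chain_def)
    interpret prob_space "P x" by fact
    have [measurable]: "(\<lambda>y. emeasure (?K y) B) \<in> borel_measurable borel"
      using measurable_compose[OF K[THEN measurable_prob_algebraD] measurable_emeasure_subprob_algebra[OF B]] .
    have "hit_prob P X 2 x B = (\<integral>\<^sup>+\<omega>. emeasure (?K (X 1 \<omega>)) B \<partial>P x)"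
      using hit_prob_Suc[OF chain B, of 1 x] by (simp add: numeral_2_eq_2)
    also have "\<dots> = (\<integral>\<^sup>+\<omega>. (\<integral>\<^sup>+y. emeasure (?K y) B \<partial>?K (X 0 \<omega>)) \<partial>P x)"
      by (intro nn_integral_chain_Suc[OF chain, where n = 0, unfolded One_nat_def[symmetric]]) measurable
    also have "\<dots> = (\<integral>\<^sup>+\<omega>. (\<integral>\<^sup>+y. emeasure (?K y) B \<partial>?K x) \<partial>P x)"
      using X0 by (intro nn_integral_cong_AE) (auto elim!: eventually_mono)
    also have "\<dots> = (\<integral>\<^sup>+y. emeasure (?K y) B \<partial>?K x)"
      by (simp add: emeasure_space_1)
    also have "0 < \<dots>"
    proof -
      obtain s where s: "\<And>y. s \<le> y \<Longrightarrow> 0 < f x y" using pos by blast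
      define L where "L = max (s + x) (max r (r + 1))"
      have "0 < emeasure (?K x) {L..L + 1}"
        by (rule emeasure_jump_kernel_pos) (use meas in \<open>auto simp: L_def intro!: s\<close>)
      moreover have "0 < emeasure (?K y) B" if "y \<in> {L..L + 1}" for y
      proof -
        have "0 < emeasure (?K y) (B \<inter> {0..1})"
          using B01 that by (intro emeasure_jump_kernel_pos) (auto simp: L_def intro!: far meas)
        also have "\<dots> \<le> emeasure (?K y) B"
          by (intro emeasure_mono) (auto simp: jump_kernel_def)
        finally show ?thesis .
      qed
      ultimately show ?thesis
      proof (rule_tac ccontr)
        assume "0 < emeasure (?K x) {L..L + 1}" and gt: "\<And>y. y \<in> {L..L + 1} \<Longrightarrow> 0 < emeasure (?K y) B"
          and "\<not> 0 < (\<integral>\<^sup>+y. emeasure (?K y) B \<partial>?K x)"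
        moreover have [measurable_cong]: "sets (?K x) = sets borel" by (simp add: jump_kernel_def)
        ultimately have "AE y in ?K x. emeasure (?K y) B = 0"
          by (subst nn_integral_0_iff_AE[symmetric]) auto
        then have "AE y in ?K x. y \<notin> {L..L + 1}"
          by eventually_elim (use gt in force)
        then have "emeasure (?K x) {L..L + 1} = 0"
          by (subst (asm) AE_iff_measurable[of "{L..L + 1}"]) (auto simp: jump_kernel_def)
        then show False using \<open>0 < emeasure (?K x) {L..L + 1}\<close> by simp
      qed
    qed
    finally show "0 < hit_prob P X 2 x B" .
  qed simp
qed simp

section \<open>The relative drift of a heavy-tailed jump density\<close>

lemma jump_gain_abs_le:
  assumes "0 < \<beta>" "\<beta> < 1" "\<bar>u\<bar> \<le> 1 / 2"
  shows "\<bar>jump_gain \<beta> u\<bar> \<le> 2 * \<bar>u\<bar>"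
proof (cases "0 \<le> u")
  case True
  have "(1 + u) powr (- 1) \<le> (1 + u) powr (- \<beta>)"
    using assms True by (intro powr_mono) auto
  moreover have "(1 + u) powr (- \<beta>) \<le> (1 + u) powr 0"
    using assms True by (intro powr_mono) auto
  moreover have "1 - (1 + u) powr (- 1) \<le> u"
    using True by (simp add: powr_minus field_simps)
  ultimately show ?thesis using True by (simp add: jump_gain_def)
next
  case False
  have "(1 + u) powr (- \<beta>) \<le> (1 + u) powr (- 1)"
    using assms False by (intro powr_mono') auto
  moreover have "(1 + u) powr 0 \<le> (1 + u) powr (- \<beta>)"
    using assms False by (intro powr_mono') auto
  moreover have "(1 + u) powr (- 1) - 1 \<le> 2 * (- u)"
  proof -
    have "u * (1 + 2 * u) \<le> 0" using assms False by (intro mult_nonpos_nonneg) auto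
    then show ?thesis using assms False by (simp add: powr_minus field_simps)
  qed
  ultimately show ?thesis using assms False by (simp add: jump_gain_def)
qed

text \<open>
  Replacing \<open>1 + \<bar>x + y\<bar>\<close> by the smaller \<open>\<bar>1 + \<bar>x\<bar> + sgn x * y\<bar>\<close> makes the gain a function of
  \<open>y / (1 + \<bar>x\<bar>)\<close> alone.  At the excluded point the convention \<open>0 powr (- \<beta>) = 0\<close> would make the
  left-hand side 1.
\<close>
lemma jump_gain_le_relative_gain:
  assumes "0 < \<beta>" "x \<noteq> 0" "sgn x * y \<noteq> - (1 + \<bar>x\<bar>)"
  shows "jump_gain \<beta> (sgn x * y / (1 + \<bar>x\<bar>)) \<le> 1 - ((1 + \<bar>x + y\<bar>) / (1 + \<bar>x\<bar>)) powr (- \<beta>)"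
proof -
  have eq: "\<bar>1 + sgn x * y / (1 + \<bar>x\<bar>)\<bar> = \<bar>1 + \<bar>x\<bar> + sgn x * y\<bar> / (1 + \<bar>x\<bar>)"
    by (simp add: field_simps abs_divide)
  have "\<bar>1 + \<bar>x\<bar> + sgn x * y\<bar> \<le> 1 + \<bar>x + y\<bar>"
    using assms by (auto simp: sgn_if abs_if split: if_splits)
  then have "\<bar>1 + sgn x * y / (1 + \<bar>x\<bar>)\<bar> \<le> (1 + \<bar>x + y\<bar>) / (1 + \<bar>x\<bar>)"
    unfolding eq by (intro divide_right_mono) auto
  moreover have "0 < \<bar>1 + sgn x * y / (1 + \<bar>x\<bar>)\<bar>"
    unfolding eq using assms by (auto simp: field_simps)
  ultimately show ?thesis
    unfolding jump_gain_def using assms by (intro diff_left_mono powr_mono2') auto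
qed

lemma relative_gain_central:
  fixes x y :: real
  assumes "x \<noteq> 0" "\<bar>y\<bar> \<le> \<bar>x\<bar>"
  shows "(1 + \<bar>x + y\<bar>) / (1 + \<bar>x\<bar>) = 1 + sgn x * (y / (1 + \<bar>x\<bar>))"
proof -
  have "1 + \<bar>x + y\<bar> = 1 + \<bar>x\<bar> + sgn x * y"
  proof (cases "0 < x")
    case True
    show ?thesis unfolding sgn_pos[OF True] using True assms(2) by linarith
  next
    case False
    then have neg: "x < 0" using assms(1) by simp
    show ?thesis unfolding sgn_neg[OF neg] using neg assms(2) by linarith
  qed
  then show ?thesis by (simp add: field_simps)
qed

text \<open>
  Here \<open>p\<close> is the value of a density whose relative distance from \<open>c / q\<close> is at most \<open>\<eta>\<close>, and
  \<open>h\<close> is a gain of either sign, so the error is measured by \<open>\<bar>h / q\<bar>\<close>.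
\<close>
lemma bound_of_ratio:
  fixes p q h :: real
  assumes "\<bar>p * (q / c) - 1\<bar> \<le> \<eta>" "0 < c" "0 < q"
  shows "c * (h / q - \<eta> * \<bar>h / q\<bar>) \<le> h * p"
proof -
  have "\<bar>h / q\<bar> * \<bar>p * q - c\<bar> \<le> \<bar>h / q\<bar> * (c * \<eta>)"
  proof (intro mult_left_mono)
    have "\<bar>p * q - c\<bar> = c * \<bar>p * (q / c) - 1\<bar>"
      using assms by (simp add: abs_mult[symmetric, of c, simplified] abs_mult_pos[symmetric] algebra_simps)
        (simp add: abs_if field_simps)
    then show "\<bar>p * q - c\<bar> \<le> c * \<eta>" using assms by simp
  qed simp
  then have "\<bar>h / q * (p * q - c)\<bar> \<le> c * \<eta> * \<bar>h / q\<bar>" by (simp add: abs_mult mult.commute)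
  moreover have "h / q * (p * q - c) = h * p - c * (h / q)"
    using assms by (simp add: field_simps)
  ultimately show ?thesis by (simp add: algebra_simps abs_le_iff)
qed

lemma integrable_bounded_mult_density:
  assumes "prob_density p" and [measurable]: "g \<in> borel_measurable borel" and "\<And>y. \<bar>g y\<bar> \<le> B"
  shows "integrable lborel (\<lambda>y. g y * p y)"
proof -
  have [measurable]: "p \<in> borel_measurable borel" and p: "\<And>y. 0 \<le> p y"
    and "(\<integral>\<^sup>+y. ennreal (p y) \<partial>lborel) = 1"
    using assms by (auto simp: prob_density_def)
  then have "integrable lborel p"
    by (intro integrableI_nn_integral_finite[where x = 1]) auto
  then have "integrable lborel (\<lambda>y. B * p y)" by simp
  then show ?thesis
  proof (rule Bochner_Integration.integrable_bound)
    show "AE y in lborel. norm (g y * p y) \<le> norm (B * p y)"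
      using assms(3) p by (auto simp: abs_mult intro!: mult_right_mono order_trans[OF assms(3)])
  qed measurable
qed

lemma integral_scaled_weighted_gain:
  assumes \<alpha>: "0 < \<alpha>" "\<alpha> < 1" and \<beta>: "0 < \<beta>" "\<beta> < 1" and m: "0 < m" and \<sigma>: "\<bar>\<sigma>\<bar> = 1"
  defines "q \<equiv> \<lambda>y. jump_gain \<beta> (\<sigma> * y / m) / \<bar>y\<bar> powr (\<alpha> + 1)"
  shows "has_bochner_integral lborel (\<lambda>y. indicator (- {-a..a}) y * q y - \<eta> * \<bar>q y\<bar>)
    (m powr (- \<alpha>) * (LBINT u. indicator (- {-(a / m)..a / m}) u * weighted_gain \<alpha> \<beta> u - \<eta> * \<bar>weighted_gain \<alpha> \<beta> u\<bar>))"
    (is "has_bochner_integral lborel ?F (_ * ?Z)")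
proof -
  let ?G = "\<lambda>u. indicator (- {-(a / m)..a / m}) u * weighted_gain \<alpha> \<beta> u - \<eta> * \<bar>weighted_gain \<alpha> \<beta> u\<bar>"
  have Q: "integrable lborel (weighted_gain \<alpha> \<beta>)"
    using integral_weighted_gain[OF \<alpha> \<beta>] by (simp add: has_bochner_integral_iff)
  have G: "integrable lborel ?G"
    using integrable_mult_indicator[OF _ Q, of "- {-(a / m)..a / m}"] Q by auto
  have \<sigma>2: "\<sigma> * \<sigma> = 1" using \<sigma> by (auto simp: abs_if split: if_splits)
  have scale: "?F (0 + (\<sigma> * m) * u) = m powr (- \<alpha> - 1) * ?G u" for u
  proof -
    have abs: "\<bar>\<sigma> * m * u\<bar> = m * \<bar>u\<bar>" using m \<sigma> by (simp add: abs_mult)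
    have "q (\<sigma> * m * u) = jump_gain \<beta> (\<sigma> * \<sigma> * u) / (m * \<bar>u\<bar>) powr (\<alpha> + 1)"
      unfolding q_def abs using m by (simp add: mult.assoc)
    also have "\<dots> = m powr (- \<alpha> - 1) * weighted_gain \<alpha> \<beta> u"
    proof -
      have "inverse ((m * \<bar>u\<bar>) powr (\<alpha> + 1)) = (m * \<bar>u\<bar>) powr (- \<alpha> - 1)"
        by (simp add: powr_minus[symmetric])
      then show ?thesis
        using m by (simp add: \<sigma>2 weighted_gain_def powr_mult divide_inverse)
    qed
    finally have q: "q (\<sigma> * m * u) = m powr (- \<alpha> - 1) * weighted_gain \<alpha> \<beta> u" .
    have "\<sigma> * m * u \<in> {-a..a} \<longleftrightarrow> \<bar>\<sigma> * m * u\<bar> \<le> a" by auto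
    also have "\<dots> \<longleftrightarrow> \<bar>u\<bar> \<le> a / m" unfolding abs using m by (simp add: field_simps)
    also have "\<dots> \<longleftrightarrow> u \<in> {-(a / m)..a / m}" by auto
    finally have ind: "indicator (- {-a..a}) (\<sigma> * m * u) = (indicator (- {-(a / m)..a / m}) u :: real)"
      by (simp add: indicator_def)
    show ?thesis unfolding add_0_left q ind by (simp add: abs_mult algebra_simps)
  qed
  have "\<sigma> * m \<noteq> 0" using m \<sigma> by auto
  have "integrable lborel (\<lambda>u. ?F (0 + (\<sigma> * m) * u))"
    unfolding scale using G by simp
  then have i: "integrable lborel ?F"
    using lborel_integrable_real_affine_iff[OF \<open>\<sigma> * m \<noteq> 0\<close>, of ?F 0] by simp
  have "(LBINT y. ?F y) = \<bar>\<sigma> * m\<bar> *\<^sub>R (LBINT u. ?F (0 + (\<sigma> * m) * u))"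
    by (rule lborel_integral_real_affine) fact
  also have "\<dots> = m * (m powr (- \<alpha> - 1) * ?Z)"
    unfolding scale using m \<sigma> by (simp add: abs_mult)
  also have "\<dots> = m powr (- \<alpha>) * ?Z"
    using powr_mult_base[of m "- \<alpha> - 1"] m by (simp add: mult.assoc[symmetric])
  finally show ?thesis using i by (simp add: has_bochner_integral_iff)
qed

text \<open>
  Pointwise lower bounds on three ranges.  For \<open>\<bar>y\<bar> \<le> a\<close> the integrand is kept.  For
  \<open>\<bar>y\<bar> > a'\<close> the density is replaced by its tail with relative error \<open>\<eta>\<close>.  In between only the
  relative error 1 is available; there the gain is at most \<open>2 * \<bar>y\<bar> / m\<close> in absolute
  value, so it costs at most \<open>2 / m\<close> per unit length, whence the error term \<open>4 * a' / m\<close>.  The two radii are separate so that \<open>a'\<close> can be chosen after the margin that the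
  drift hypothesis provides for \<open>a\<close>.
\<close>
proposition relative_drift_ge:
  assumes p: "prob_density p" and \<alpha>: "0 < \<alpha>" "\<alpha> < 1" and \<beta>: "0 < \<beta>" "\<beta> < 1" and c: "0 < c" and \<eta>: "0 \<le> \<eta>"
    and a: "1 \<le> a" "a \<le> a'" "2 * a' \<le> \<bar>x\<bar>"
    and near: "\<And>y. a \<le> \<bar>y\<bar> \<Longrightarrow> \<bar>p y * (\<bar>y\<bar> powr (\<alpha> + 1) / c) - 1\<bar> \<le> 1"
    and far: "\<And>y. a' \<le> \<bar>y\<bar> \<Longrightarrow> \<bar>p y * (\<bar>y\<bar> powr (\<alpha> + 1) / c) - 1\<bar> \<le> \<eta>"
  defines "m \<equiv> 1 + \<bar>x\<bar>"
  shows "(LBINT y:{-a..a}. (1 - (1 + sgn x * (y / m)) powr (- \<beta>)) * p y)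
      + c * (m powr (- \<alpha>) * (LBINT u. indicator (- {-(a / m)..a / m}) u * weighted_gain \<alpha> \<beta> u - \<eta> * \<bar>weighted_gain \<alpha> \<beta> u\<bar>))
      - c * (4 * a' / m)
    \<le> (LBINT y. (1 - ((1 + \<bar>x + y\<bar>) / m) powr (- \<beta>)) * p y)" (is "?I + c * ?Z - _ \<le> ?D")
proof -
  have m: "1 \<le> m" and x: "x \<noteq> 0" using a by (auto simp: m_def)
  have p_meas[measurable]: "p \<in> borel_measurable borel" and p0: "\<And>y. 0 \<le> p y"
    using p by (auto simp: prob_density_def)
  define q where "q y = jump_gain \<beta> (sgn x * y / m) / \<bar>y\<bar> powr (\<alpha> + 1)" for y
  let ?g = "\<lambda>y. 1 - ((1 + \<bar>x + y\<bar>) / m) powr (- \<beta>)"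
  let ?l = "\<lambda>y. indicator {-a..a} y * ((1 - (1 + sgn x * (y / m)) powr (- \<beta>)) * p y)"
  let ?F = "\<lambda>y. indicator (- {-a..a}) y * q y - \<eta> * \<bar>q y\<bar>"
  have D: "integrable lborel (\<lambda>y. ?g y * p y)"
  proof (rule integrable_bounded_mult_density[OF p])
    fix y
    have "(1 / m) powr (- \<beta>) \<ge> ((1 + \<bar>x + y\<bar>) / m) powr (- \<beta>)"
      using m \<beta> by (intro powr_mono2' divide_right_mono) auto
    moreover have "0 \<le> ((1 + \<bar>x + y\<bar>) / m) powr (- \<beta>)" by simp
    ultimately show "\<bar>?g y\<bar> \<le> 1 + (1 / m) powr (- \<beta>)" by linarith
  qed measurable
  have l_eq: "?l y = indicator {-a..a} y * (?g y * p y)" for y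
    using relative_gain_central[OF x, of y] a by (auto simp: indicator_def m_def)
  then have l: "integrable lborel ?l"
    unfolding l_eq using integrable_mult_indicator[OF _ D, of "{-a..a}"] by simp
  have F: "has_bochner_integral lborel ?F ?Z"
    unfolding q_def by (rule integral_scaled_weighted_gain) (use \<alpha> \<beta> m x in \<open>auto simp: abs_sgn_eq\<close>)
  have e: "has_bochner_integral lborel (\<lambda>y. indicator {-a'..a'} y * (2 / m)) (4 * a' / m)"
    using a by (auto simp: has_bochner_integral_iff intro!: integrable_real_indicator)
  have le: "?l y + c * ?F y - c * (indicator {-a'..a'} y * (2 / m)) \<le> ?g y * p y"
    if y: "y \<noteq> - sgn x * m" for y
  proof -
    have hg: "jump_gain \<beta> (sgn x * y / m) * p y \<le> ?g y * p y"
    proof (intro mult_right_mono p0)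
      have "sgn x * y \<noteq> - (1 + \<bar>x\<bar>)"
        using y x by (auto simp: m_def sgn_if split: if_splits)
      then show "jump_gain \<beta> (sgn x * y / m) \<le> ?g y"
        using jump_gain_le_relative_gain[OF \<beta>(1) x] by (simp add: m_def)
    qed
    have main: "c * (q y - \<delta> * \<bar>q y\<bar>) \<le> ?g y * p y"
      if "\<bar>p y * (\<bar>y\<bar> powr (\<alpha> + 1) / c) - 1\<bar> \<le> \<delta>" "y \<noteq> 0" for \<delta>
      using bound_of_ratio[OF that(1) c, of "jump_gain \<beta> (sgn x * y / m)"] that(2) hg
      unfolding q_def by simp
    have \<eta>q: "0 \<le> \<eta> * \<bar>q y\<bar>" using \<eta> by simp
    consider "\<bar>y\<bar> \<le> a" | "a < \<bar>y\<bar>" "\<bar>y\<bar> \<le> a'" | "a' < \<bar>y\<bar>" by linarith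
    then show ?thesis
    proof cases
      case 1
      then have "?l y = ?g y * p y" unfolding l_eq by (simp add: indicator_def abs_le_iff)
      moreover have "c * ?F y \<le> 0"
        using 1 \<eta>q c by (auto simp: indicator_def abs_le_iff mult_le_0_iff)
      moreover have "0 \<le> c * (indicator {-a'..a'} y * (2 / m))" using c m by simp
      ultimately show ?thesis by linarith
    next
      case 2
      have q2: "\<bar>q y\<bar> \<le> 2 / m"
      proof -
        have y1: "1 \<le> \<bar>y\<bar>" using 2 a by linarith
        have u: "\<bar>sgn x * y / m\<bar> = \<bar>y\<bar> / m" using x m by (simp add: abs_mult abs_sgn_eq)
        have "\<bar>y\<bar> / m \<le> 1 / 2" using 2 a m by (simp add: m_def field_simps)
        then have h: "\<bar>jump_gain \<beta> (sgn x * y / m)\<bar> \<le> 2 * (\<bar>y\<bar> / m)"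
          using jump_gain_abs_le[OF \<beta>, of "sgn x * y / m"] unfolding u by blast
        have "\<bar>y\<bar> powr 1 \<le> \<bar>y\<bar> powr (\<alpha> + 1)" using y1 \<alpha> by (intro powr_mono) auto
        then have "2 * (\<bar>y\<bar> / m) \<le> 2 / m * \<bar>y\<bar> powr (\<alpha> + 1)"
          using m y1 by (simp add: divide_right_mono)
        with h have "\<bar>jump_gain \<beta> (sgn x * y / m)\<bar> \<le> 2 / m * \<bar>y\<bar> powr (\<alpha> + 1)" by linarith
        then show ?thesis using y1 unfolding q_def abs_divide by (subst pos_divide_le_eq) auto
      qed
      have "c * (q y - 1 * \<bar>q y\<bar>) \<le> ?g y * p y"
        using 2 a by (intro main near) auto
      moreover have "c * (?F y - 2 / m) \<le> c * (q y - 1 * \<bar>q y\<bar>)"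
        using 2 q2 \<eta>q c by (intro mult_left_mono) (auto simp: indicator_def abs_le_iff)
      moreover have "indicator {-a..a} y = (0::real)" using 2 by (auto simp: indicator_def)
      moreover have "indicator {-a'..a'} y = (1::real)" using 2 by (auto simp: indicator_def)
      ultimately show ?thesis by (simp add: algebra_simps)
    next
      case 3
      have "c * (q y - \<eta> * \<bar>q y\<bar>) \<le> ?g y * p y"
        using 3 a by (intro main far) auto
      moreover have "indicator {-a..a} y = (0::real)" "indicator (- {-a..a}) y = (1::real)"
        using 3 a by (auto simp: indicator_def)
      moreover have "indicator {-a'..a'} y = (0::real)" using 3 by (auto simp: indicator_def)
      ultimately show ?thesis by simp
    qed
  qed
  have "has_bochner_integral lborel ?l ?I"
    using l by (simp add: has_bochner_integral_iff set_lebesgue_integral_def)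
  then have L: "has_bochner_integral lborel (\<lambda>y. ?l y + c * ?F y - c * (indicator {-a'..a'} y * (2 / m)))
      (?I + c * ?Z - c * (4 * a' / m))"
    by (intro has_bochner_integral_diff has_bochner_integral_add has_bochner_integral_mult_right F e)
  then have "?I + c * ?Z - c * (4 * a' / m) = (LBINT y. ?l y + c * ?F y - c * (indicator {-a'..a'} y * (2 / m)))"
    by (rule has_bochner_integral_integral_eq[symmetric])
  also have "\<dots> \<le> ?D"
  proof (rule integral_mono_AE)
    show "AE y in lborel. ?l y + c * ?F y - c * (indicator {-a'..a'} y * (2 / m)) \<le> ?g y * p y"
      using AE_lborel_singleton[of "- sgn x * m"] by eventually_elim (rule le)
  qed (use L D in \<open>auto simp: has_bochner_integral_iff\<close>)
  finally show ?thesis .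
qed

section \<open>Positivity of the drift far from the origin\<close>

lemma integral_jump_kernel:
  assumes [measurable]: "f x \<in> borel_measurable borel" "g \<in> borel_measurable borel" and "\<And>y. 0 \<le> f x y"
  shows "(\<integral>z. g z \<partial>jump_kernel f x) = (LBINT y. g (x + y) * f x y)"
proof -
  have "(\<integral>z. g z \<partial>jump_kernel f x) = (LBINT z. f x (z - x) * g z)"
    unfolding jump_kernel_def using assms by (subst integral_density) auto
  also have "\<dots> = (LBINT y. f x (x + 1 * y - x) * g (x + 1 * y))"
    by (subst lborel_integral_real_affine[of 1 _ x]) auto
  finally show ?thesis by (simp add: mult.commute)
qed

text \<open>
  The drift hypothesis is used for one radius \<open>a\<close>, beyond which the density has relative error at
  most 1.  Its margin \<open>\<delta>\<close> then determines \<open>b\<close>, with \<open>T_const b \<beta>\<close> within \<open>\<delta> / 4\<close> of the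
  critical value, and \<open>\<eta>\<close>, whose cost is at most \<open>\<delta> / 4\<close>.  The remaining errors are of order
  \<open>m powr (- 1)\<close>, from exchanging \<open>\<bar>x\<bar> powr \<alpha> x\<close> for \<open>m powr \<alpha> x\<close>, and \<open>m powr (b - 1)\<close>, from
  the range between the radii, and vanish at infinity because \<open>b < 1\<close>.
\<close>
lemma eventually_drift_positive:
  fixes \<alpha> c :: "real \<Rightarrow> real"
  assumes alpha: "\<And>x. 0 < \<alpha> x"
    and limsup: "Limsup at_infinity (\<lambda>x. ereal (\<alpha> x)) = ereal \<alpha>\<^sub>0" and less: "\<alpha>\<^sub>0 < 1"
    and \<beta>: "0 < \<beta>" "\<beta> < 1" and c: "\<And>x. 0 < c x"
    and dens: "\<And>x. prob_density (f x)"
    and unif: "\<And>\<epsilon>. 0 < \<epsilon> \<Longrightarrow> \<exists>r. \<forall>y. r \<le> \<bar>y\<bar> \<longrightarrow> (\<forall>x. k < \<bar>x\<bar> \<longrightarrow> \<bar>f x y * (\<bar>y\<bar> powr (\<alpha> x + 1) / c x) - 1\<bar> \<le> \<epsilon>)"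
    and drift: "\<And>a. a\<^sub>0 \<le> a \<Longrightarrow>
        Liminf at_infinity (\<lambda>x. ereal (\<alpha> x * \<bar>x\<bar> powr \<alpha> x / c x *
          (LBINT y:{-a..a}. (1 - (1 + sgn x * (y / (1 + \<bar>x\<bar>))) powr (- \<beta>)) * f x y)))
        > ereal (- T_const \<alpha>\<^sub>0 \<beta>)"
  shows "eventually (\<lambda>x. 0 < (LBINT y. (1 - ((1 + \<bar>x + y\<bar>) / (1 + \<bar>x\<bar>)) powr (- \<beta>)) * f x y)) at_infinity"
proof -
  have a0: "0 \<le> \<alpha>\<^sub>0"
  proof -
    have "ereal 0 \<le> Limsup at_infinity (\<lambda>x. ereal (\<alpha> x))"
      by (intro le_Limsup always_eventually) (auto intro: less_imp_le alpha simp: trivial_limit_at_infinity)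
    then show ?thesis by (simp add: limsup)
  qed
  obtain r\<^sub>1 where r1: "\<And>x y. r\<^sub>1 \<le> \<bar>y\<bar> \<Longrightarrow> k < \<bar>x\<bar> \<Longrightarrow> \<bar>f x y * (\<bar>y\<bar> powr (\<alpha> x + 1) / c x) - 1\<bar> \<le> 1"
    using unif[of 1] by auto
  define a where "a = max 1 (max a\<^sub>0 r\<^sub>1)"
  let ?I = "\<lambda>x. LBINT y:{-a..a}. (1 - (1 + sgn x * (y / (1 + \<bar>x\<bar>))) powr (- \<beta>)) * f x y"
  obtain s where s: "ereal (- T_const \<alpha>\<^sub>0 \<beta>) < ereal s" "ereal s < Liminf at_infinity (\<lambda>x. ereal (\<alpha> x * \<bar>x\<bar> powr \<alpha> x / c x * ?I x))"
  proof -
    have "a\<^sub>0 \<le> a" by (simp add: a_def)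
    from ereal_dense2[OF drift[OF this]] show ?thesis using that by blast
  qed
  define \<delta> where "\<delta> = s + T_const \<alpha>\<^sub>0 \<beta>"
  have \<delta>: "0 < \<delta>" using s(1) by (simp add: \<delta>_def)
  have ev1: "eventually (\<lambda>x. s < \<alpha> x * \<bar>x\<bar> powr \<alpha> x / c x * ?I x) at_infinity"
    using less_LiminfD[OF s(2)] by simp
  obtain b where b: "\<alpha>\<^sub>0 < b" "b < 1" "T_const \<alpha>\<^sub>0 \<beta> - \<delta> / 4 < T_const b \<beta>"
    using T_const_lower_semicontinuous_right[OF \<beta> a0 less, of "\<delta> / 4"] \<delta> by auto
  have ev2: "eventually (\<lambda>x. \<alpha> x < b) at_infinity"
    using Limsup_lessD[of at_infinity "\<lambda>x. ereal (\<alpha> x)" "ereal b"] limsup b(1) by simp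
  define M where "M = max 1 (gain_bound b \<beta>)"
  define \<eta> where "\<eta> = \<delta> / (4 * M)"
  have M: "1 \<le> M" "gain_bound b \<beta> \<le> M" by (auto simp: M_def)
  have \<eta>: "0 < \<eta>" using \<delta> M by (auto simp: \<eta>_def)
  have "\<eta> * gain_bound b \<beta> \<le> \<eta> * M" using \<eta> M by (intro mult_left_mono) auto
  then have \<eta>M: "\<eta> * gain_bound b \<beta> \<le> \<delta> / 4" using M by (simp add: \<eta>_def)
  obtain r\<^sub>2 where r2: "\<And>x y. r\<^sub>2 \<le> \<bar>y\<bar> \<Longrightarrow> k < \<bar>x\<bar> \<Longrightarrow> \<bar>f x y * (\<bar>y\<bar> powr (\<alpha> x + 1) / c x) - 1\<bar> \<le> \<eta>"
    using unif[OF \<eta>] by auto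
  define a' where "a' = max a r\<^sub>2"
  have a: "1 \<le> a" "a \<le> a'" by (auto simp: a_def a'_def)
  define T where "T = T_const b \<beta> - \<eta> * gain_bound b \<beta>"
  have lim: "((\<lambda>x::real. \<bar>T\<bar> * (1 + \<bar>x\<bar>) powr (- 1) + 4 * a' * (1 + \<bar>x\<bar>) powr (b - 1)) \<longlongrightarrow> \<bar>T\<bar> * 0 + 4 * a' * 0) at_infinity"
  proof -
    have "norm = (abs :: real \<Rightarrow> real)" by (simp add: fun_eq_iff)
    then have "filterlim (\<lambda>x::real. 1 + \<bar>x\<bar>) at_top at_infinity"
      using filterlim_norm_at_top[where 'a = real]
      by (intro filterlim_tendsto_add_at_top[OF tendsto_const]) simp
    then have z: "((\<lambda>x::real. (1 + \<bar>x\<bar>) powr p) \<longlongrightarrow> 0) at_infinity" if "p < 0" for p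
      using that by (rule tendsto_neg_powr[rotated])
    show ?thesis
      using b by (intro tendsto_add tendsto_mult tendsto_const z) simp_all
  qed
  then have ev3: "eventually (\<lambda>x::real. \<bar>T\<bar> * (1 + \<bar>x\<bar>) powr (- 1) + 4 * a' * (1 + \<bar>x\<bar>) powr (b - 1) < \<delta> / 2) at_infinity"
    using \<delta> by (intro order_tendstoD(2)[OF lim]) auto
  have ev4: "eventually (\<lambda>x::real. max (k + 1) (2 * a') \<le> \<bar>x\<bar>) at_infinity"
    unfolding eventually_at_infinity by (intro exI[of _ "max (k + 1) (2 * a')"]) simp
  from ev1 ev2 ev3 ev4 show ?thesis
  proof eventually_elim
    case (elim x)
    define m where "m = 1 + \<bar>x\<bar>"
    define A where "A = \<alpha> x"
    have A: "0 < A" "A < b" using alpha elim by (auto simp: A_def)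
    have x: "0 < \<bar>x\<bar>" "\<bar>x\<bar> < m" "2 * a' \<le> \<bar>x\<bar>" "k < \<bar>x\<bar>" "1 \<le> m"
      using elim a by (auto simp: m_def)
    let ?D = "LBINT y. (1 - ((1 + \<bar>x + y\<bar>) / m) powr (- \<beta>)) * f x y"
    define Z where "Z = (LBINT u. indicator (- {-(a / m)..a / m}) u * weighted_gain A \<beta> u - \<eta> * \<bar>weighted_gain A \<beta> u\<bar>)"
    have D: "?I x + c x * (m powr (- A) * Z) - c x * (4 * a' / m) \<le> ?D"
      unfolding Z_def m_def
      using A b \<beta> c \<eta> a x r1[OF _ x(4)] r2[OF _ x(4)]
      by (intro relative_drift_ge dens) (auto simp: A_def a_def a'_def)
    have Z: "T \<le> A * Z"
      unfolding T_def Z_def using A b \<beta> \<eta> a x by (intro truncated_gain_ge) (auto simp: field_simps)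
    define S where "S = A * \<bar>x\<bar> powr A / c x"
    have S: "0 < S" using A x c by (simp add: S_def)
    have "S * ?I x + S * (c x * (m powr (- A) * Z)) - S * (c x * (4 * a' / m)) \<le> S * ?D"
      using mult_left_mono[OF D, of S] S by (simp add: algebra_simps)
    moreover have "s < S * ?I x" using elim by (simp add: S_def A_def)
    moreover have "T - \<bar>T\<bar> * m powr (- 1) \<le> S * (c x * (m powr (- A) * Z))"
    proof -
      define \<theta> where "\<theta> = (\<bar>x\<bar> / m) powr A"
      have "(\<bar>x\<bar> / m) powr 1 \<le> \<theta>" unfolding \<theta>_def using x A b by (intro powr_mono') auto
      moreover have "(\<bar>x\<bar> / m) powr 1 = 1 - m powr (- 1)" using x by (simp add: m_def powr_minus field_simps)
      moreover have "\<theta> \<le> 1" unfolding \<theta>_def using x A by (intro powr_le1) auto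
      ultimately have \<theta>: "1 - m powr (- 1) \<le> \<theta>" "\<theta> \<le> 1" "0 \<le> \<theta>" by (auto simp: \<theta>_def)
      have "\<bar>T\<bar> * (1 - \<theta>) \<le> \<bar>T\<bar> * m powr (- 1)" using \<theta> by (intro mult_left_mono) auto
      moreover have "T * (1 - \<theta>) \<le> \<bar>T\<bar> * (1 - \<theta>)" using \<theta> by (intro mult_right_mono) auto
      ultimately have "T - \<bar>T\<bar> * m powr (- 1) \<le> \<theta> * T" by (simp add: algebra_simps)
      also have "\<dots> \<le> \<theta> * (A * Z)" using Z \<theta> by (intro mult_left_mono) auto
      also have "\<dots> = S * (c x * (m powr (- A) * Z))"
        using c[of x] x by (simp add: S_def \<theta>_def powr_divide powr_minus field_simps)
      finally show ?thesis .
    qed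
    moreover have "S * (c x * (4 * a' / m)) \<le> 4 * a' * m powr (b - 1)"
    proof -
      have "A * \<bar>x\<bar> powr A \<le> 1 * m powr b"
        using A b x by (intro mult_mono order_trans[OF powr_mono2 powr_mono]) auto
      then have "A * \<bar>x\<bar> powr A * (4 * a' / m) \<le> m powr b * (4 * a' / m)"
        using a x by (intro mult_right_mono) auto
      also have "\<dots> = 4 * a' * m powr (b - 1)" using x by (simp add: powr_diff)
      finally show ?thesis using c[of x] by (simp add: S_def)
    qed
    moreover have "T \<ge> T_const \<alpha>\<^sub>0 \<beta> - \<delta> / 2" using b \<eta>M by (simp add: T_def)
    moreover have "\<bar>T\<bar> * m powr (- 1) + 4 * a' * m powr (b - 1) < \<delta> / 2"
      using elim(3) by (simp only: m_def)
    moreover have "s = \<delta> - T_const \<alpha>\<^sub>0 \<beta>" by (simp add: \<delta>_def)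
    ultimately have "0 < S * ?D" by linarith
    then show ?case using S by (simp add: m_def zero_less_mult_iff)
  qed
qed

section \<open>Transience of the jump chain\<close>

text \<open>
  The subharmonic function is \<open>w z = 1 - min (u z) (u r)\<close> with
  \<open>u z = (1 + \<bar>z\<bar>) powr (- \<beta>)\<close>.  Truncating \<open>u\<close> at the level \<open>u r\<close> does no harm for \<open>\<bar>x\<bar> \<ge> r\<close>, since it only increases \<open>w\<close>
  at the places that a jump can reach, and it turns the points of \<open>[-r, r]\<close> into minimum points.
\<close>
proposition transient_jump_chain:
  fixes f :: "real \<Rightarrow> real \<Rightarrow> real"
  assumes chain: "markov_chain P X (jump_kernel f)" and dens: "\<And>x. prob_density (f x)"
    and right: "\<And>x. \<exists>r. \<forall>y\<ge>r. 0 < f x y"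
    and far: "\<And>x y. r\<^sub>0 \<le> x \<Longrightarrow> r\<^sub>0 \<le> \<bar>y\<bar> \<Longrightarrow> 0 < f x y"
    and \<beta>: "0 < \<beta>"
    and drift: "eventually (\<lambda>x. 0 < (LBINT y. (1 - ((1 + \<bar>x + y\<bar>) / (1 + \<bar>x\<bar>)) powr (- \<beta>)) * f x y)) at_infinity"
  shows "transient P X"
proof -
  have meas[measurable]: "f x \<in> borel_measurable borel" and f0: "0 \<le> f x y"
    and f1: "(\<integral>\<^sup>+y. ennreal (f x y) \<partial>lborel) = 1" for x y
    using dens by (auto simp: prob_density_def)
  have fint: "has_bochner_integral lborel (f x) 1" for x
    using f0 f1 by (intro has_bochner_integral_nn_integral) auto
  obtain r\<^sub>1 where r1: "\<And>x. r\<^sub>1 \<le> \<bar>x\<bar> \<Longrightarrow> 0 < (LBINT y. (1 - ((1 + \<bar>x + y\<bar>) / (1 + \<bar>x\<bar>)) powr (- \<beta>)) * f x y)"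
    using drift unfolding eventually_at_infinity by auto
  define r where "r = max 0 r\<^sub>1"
  define u where "u x = (1 + \<bar>x\<bar>) powr (- \<beta>)" for x :: real
  define w where "w x = 1 - min (u x) (u r)" for x
  have u: "0 < u x" "u x \<le> 1" for x
  proof -
    have pos: "0 < 1 + \<bar>x\<bar>" by linarith
    then show "0 < u x" unfolding u_def by simp
    have "u x \<le> (1 + \<bar>x\<bar>) powr 0" unfolding u_def using \<beta> by (intro powr_mono) auto
    then show "u x \<le> 1" using pos by (simp split: if_splits)
  qed
  have u_less: "u y < u x" if "\<bar>x\<bar> < \<bar>y\<bar>" for x y
    unfolding u_def using that \<beta> by (intro powr_less_mono2_neg) auto
  have [measurable]: "u \<in> borel_measurable borel" unfolding u_def by measurable
  have [measurable]: "w \<in> borel_measurable borel" unfolding w_def by measurable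
  have w01: "0 \<le> w x" "w x \<le> 1" for x
    using u[of x] u[of r] by (auto simp: w_def min_def)
  have int: "integrable lborel (\<lambda>y. g (x + y) * f x y)" if "g \<in> borel_measurable borel" "\<And>y. \<bar>g y\<bar> \<le> 1" for g :: "real \<Rightarrow> real" and x
    using that by (intro integrable_bounded_mult_density[OF dens]) (auto intro: measurable_compose[OF _ that(1)])
  have wint: "integrable lborel (\<lambda>y. w (x + y) * f x y)" for x
    using w01 by (intro int) auto
  have uint: "integrable lborel (\<lambda>y. u (x + y) * f x y)" for x
    using u by (intro int) (auto simp: less_imp_le)
  have "w x < (\<integral>z. w z \<partial>jump_kernel f x)" for x
  proof -
    have K: "(\<integral>z. w z \<partial>jump_kernel f x) = (LBINT y. w (x + y) * f x y)"
      by (rule integral_jump_kernel) (use f0 in auto)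
    show ?thesis
    proof (cases "r \<le> \<bar>x\<bar>")
      case True
      have "u x \<le> u r"
        unfolding u_def using True \<beta> by (intro powr_mono2') (auto simp: r_def)
      have "0 < u x * (LBINT y. (1 - ((1 + \<bar>x + y\<bar>) / (1 + \<bar>x\<bar>)) powr (- \<beta>)) * f x y)"
        using r1[of x] True u[of x] by (simp add: r_def)
      also have "\<dots> = (LBINT y. u x * f x y - u (x + y) * f x y)"
      proof (subst Bochner_Integration.integral_mult_right_zero[symmetric], intro Bochner_Integration.integral_cong refl)
        fix y
        have "u x * ((1 + \<bar>x + y\<bar>) / (1 + \<bar>x\<bar>)) powr (- \<beta>) = u (x + y)"
          by (simp add: u_def powr_divide)
        then show "u x * ((1 - ((1 + \<bar>x + y\<bar>) / (1 + \<bar>x\<bar>)) powr (- \<beta>)) * f x y) = u x * f x y - u (x + y) * f x y"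
          by (metis (no_types, lifting) left_diff_distrib mult.assoc mult.right_neutral right_diff_distrib)
      qed
      also have "\<dots> = u x - (LBINT y. u (x + y) * f x y)"
        using uint fint[of x] by (simp add: has_bochner_integral_iff)
      finally have "w x < 1 - (LBINT y. u (x + y) * f x y)"
        using \<open>u x \<le> u r\<close> by (simp add: w_def)
      also have "\<dots> = (LBINT y. f x y - u (x + y) * f x y)"
        using uint fint[of x] by (simp add: has_bochner_integral_iff)
      also have "\<dots> \<le> (LBINT y. w (x + y) * f x y)"
      proof (intro integral_mono wint)
        show "integrable lborel (\<lambda>y. f x y - u (x + y) * f x y)"
          using uint fint[of x] by (auto simp: has_bochner_integral_iff)
        fix y
        have "(1 - u (x + y)) * f x y \<le> w (x + y) * f x y"
          by (intro mult_right_mono f0) (auto simp: w_def)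
        then show "f x y - u (x + y) * f x y \<le> w (x + y) * f x y" by (simp add: left_diff_distrib)
      qed
      finally show ?thesis by (simp add: K)
    next
      case False
      then have wx: "w x = 1 - u r"
        using u_less[of x r] by (auto simp: w_def r_def)
      have ge: "w x \<le> w z" for z unfolding wx by (auto simp: w_def)
      obtain s where s: "\<And>y. s \<le> y \<Longrightarrow> 0 < f x y" using right by blast
      define L where "L = max (s + x) (r + 1)"
      have pos: "0 < emeasure (jump_kernel f x) {L..L + 1}"
      proof (rule emeasure_jump_kernel_pos)
        show "0 < f x (z - x)" if "z \<in> {L..L + 1}" for z
          using that by (intro s) (auto simp: L_def)
      qed auto
      have gt: "w x < w z" if "z \<in> {L..L + 1}" for z
      proof -
        have "0 \<le> r" "r + 1 \<le> z" using that by (auto simp: r_def L_def)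
        then have "u z < u r" by (intro u_less) auto
        then show ?thesis unfolding wx by (simp add: w_def)
      qed
      have sets: "sets (jump_kernel f x) = sets borel" by (simp add: jump_kernel_def)
      interpret K: prob_space "jump_kernel f x"
        using f1[of x] nn_integral_real_affine[of "\<lambda>z. ennreal (f x (z - x))" 1 x]
        by (intro prob_spaceI) (simp add: jump_kernel_def emeasure_density)
      have wK: "integrable (jump_kernel f x) w"
        using w01 by (intro K.integrable_const_bound[where B = 1]) (auto simp: measurable_cong_sets[OF sets refl])
      show ?thesis
      proof (rule ccontr)
        assume "\<not> ?thesis"
        then have "(\<integral>z. w z - w x \<partial>jump_kernel f x) \<le> 0"
          using wK by (simp add: K.prob_space)
        moreover have "0 \<le> (\<integral>z. w z - w x \<partial>jump_kernel f x)"
          using ge by (intro Bochner_Integration.integral_nonneg) simp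
        ultimately have "AE z in jump_kernel f x. w z - w x = 0"
          using wK ge by (subst integral_nonneg_eq_0_iff_AE[symmetric]) auto
        then have "AE z in jump_kernel f x. z \<notin> {L..L + 1}"
          by eventually_elim (use gt in force)
        then have "emeasure (jump_kernel f x) {L..L + 1} = 0"
          by (subst (asm) AE_iff_measurable[of "{L..L + 1}"]) (auto simp: jump_kernel_def)
        then show False using pos by simp
      qed
    qed
  qed
  moreover have "phi_irreducible P X"
    by (rule phi_irreducible_jump_chain[OF chain meas right far])
  ultimately show ?thesis
    using w01 by (intro transient_if_bounded_strictly_subharmonic[OF chain, where w = w]) auto
qed

theorem theorem1p4:
  fixes \<alpha> c :: "real \<Rightarrow> real"
    and \<alpha>\<^sub>0 \<beta> k a\<^sub>0 :: real
    and f :: "real \<Rightarrow> real \<Rightarrow> real"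
    and P :: "real \<Rightarrow> 'w measure"
    and X :: "nat \<Rightarrow> 'w \<Rightarrow> real"
  assumes alpha: "\<And>x. 0 < \<alpha> x \<and> \<alpha> x < 1"
    and alpha_limsup: "Limsup at_infinity (\<lambda>x. ereal (\<alpha> x)) = ereal \<alpha>\<^sub>0"
    and alpha_limsup_less: "\<alpha>\<^sub>0 < 1"
    and beta: "0 < \<beta>" "\<beta> < 1 - \<alpha>\<^sub>0"
    and c_pos: "\<And>x. 0 < c x"
    and dens: "\<And>x. prob_density (f x)"
    and C1: "\<And>y. (\<lambda>x. f x y) \<in> borel_measurable borel"
    and C2: "\<And>x. f x \<sim>[at_infinity] (\<lambda>y. c x * \<bar>y\<bar> powr (- \<alpha> x - 1))"
    and k_pos: "0 < k"
    and C3: "((\<lambda>y. SUP x\<in>- {-k..k}. ereal \<bar>f x y * (\<bar>y\<bar> powr (\<alpha> x + 1) / c x) - 1\<bar>) \<longlongrightarrow> 0)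
               at_infinity"
    and C4: "\<And>C. compact C \<Longrightarrow> C \<subseteq> - {-k..k} \<Longrightarrow> (INF x\<in>C. ereal (c x)) > 0"
    and C5: "\<exists>l>0. \<forall>C. compact C \<and> C \<subseteq> - {-l..l} \<and> emeasure lborel C > 0 \<longrightarrow>
               (INF x\<in>{-k..k}. ereal (LBINT y:(\<lambda>z. z - x) ` C. f x y)) > 0"
    and a0_pos: "0 < a\<^sub>0"
    and drift: "\<And>a. a\<^sub>0 \<le> a \<Longrightarrow>
        Liminf at_infinity (\<lambda>x. ereal (\<alpha> x * \<bar>x\<bar> powr \<alpha> x / c x *
          (LBINT y:{-a..a}. (1 - (1 + sgn x * (y / (1 + \<bar>x\<bar>))) powr (- \<beta>)) * f x y)))
        > ereal (- T_const \<alpha>\<^sub>0 \<beta>)"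
    and chain: "markov_chain P X (jump_kernel f)"
  shows "transient P X"
proof -
  have unif: "\<exists>r. \<forall>y. r \<le> \<bar>y\<bar> \<longrightarrow> (\<forall>x. k < \<bar>x\<bar> \<longrightarrow> \<bar>f x y * (\<bar>y\<bar> powr (\<alpha> x + 1) / c x) - 1\<bar> \<le> \<epsilon>)"
    if "0 < \<epsilon>" for \<epsilon>
  proof -
    have "eventually (\<lambda>y. (SUP x\<in>- {-k..k}. ereal \<bar>f x y * (\<bar>y\<bar> powr (\<alpha> x + 1) / c x) - 1\<bar>) < ereal \<epsilon>) at_infinity"
      using that by (intro order_tendstoD(2)[OF C3]) (simp add: zero_ereal_def)
    then obtain r where r: "\<And>y. r \<le> \<bar>y\<bar> \<Longrightarrow> (SUP x\<in>- {-k..k}. ereal \<bar>f x y * (\<bar>y\<bar> powr (\<alpha> x + 1) / c x) - 1\<bar>) < ereal \<epsilon>"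
      unfolding eventually_at_infinity by auto
    show ?thesis
    proof (intro exI[of _ r] allI impI)
      fix y x assume "r \<le> \<bar>y\<bar>" "k < \<bar>x\<bar>"
      then have le: "ereal \<bar>f x y * (\<bar>y\<bar> powr (\<alpha> x + 1) / c x) - 1\<bar> \<le> (SUP x\<in>- {-k..k}. ereal \<bar>f x y * (\<bar>y\<bar> powr (\<alpha> x + 1) / c x) - 1\<bar>)"
        by (intro SUP_upper) auto
      from order.strict_trans1[OF le r[OF \<open>r \<le> \<bar>y\<bar>\<close>]]
      show "\<bar>f x y * (\<bar>y\<bar> powr (\<alpha> x + 1) / c x) - 1\<bar> \<le> \<epsilon>" by simp
    qed
  qed
  have pos_of_ratio: "0 < p" if "\<bar>p * (q / c') - 1\<bar> \<le> 1 / 2" "0 < c'" "0 \<le> q" for p q c' :: real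
  proof (rule ccontr)
    assume "\<not> 0 < p"
    then have "p * (q / c') \<le> 0" using that by (intro mult_nonpos_nonneg) auto
    then show False using that(1) by linarith
  qed
  obtain r where r: "\<And>x y. r \<le> \<bar>y\<bar> \<Longrightarrow> k < \<bar>x\<bar> \<Longrightarrow> \<bar>f x y * (\<bar>y\<bar> powr (\<alpha> x + 1) / c x) - 1\<bar> \<le> 1 / 2"
    using unif[of "1 / 2"] by auto
  have far: "0 < f x y" if "max r (k + 1) \<le> x" "max r (k + 1) \<le> \<bar>y\<bar>" for x y
    by (rule pos_of_ratio[OF r c_pos]) (use that k_pos in auto)
  have right: "\<exists>r. \<forall>y\<ge>r. 0 < f x y" for x
  proof -
    let ?g = "\<lambda>y. c x * \<bar>y\<bar> powr (- \<alpha> x - 1)"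
    have "eventually (\<lambda>y. 0 < (if f x y = 0 \<and> ?g y = 0 then 1 else f x y / ?g y)) at_infinity"
      using C2[of x] unfolding asymp_equiv_def by (rule order_tendstoD(1)) simp
    then obtain s where s: "\<And>y. s \<le> \<bar>y\<bar> \<Longrightarrow> 0 < (if f x y = 0 \<and> ?g y = 0 then 1 else f x y / ?g y)"
      unfolding eventually_at_infinity by auto
    have "0 < f x y" if "max s 1 \<le> y" for y
    proof -
      have "0 < ?g y" using that c_pos[of x] by simp
      then show ?thesis using s[of y] that by (auto split: if_splits simp: zero_less_divide_iff)
    qed
    then show ?thesis by blast
  qed
  have "0 \<le> \<alpha>\<^sub>0"
  proof -
    have "ereal 0 \<le> Limsup at_infinity (\<lambda>x. ereal (\<alpha> x))"
      by (intro le_Limsup always_eventually) (auto intro: less_imp_le alpha[THEN conjunct1] simp: trivial_limit_at_infinity)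
    then show ?thesis by (simp add: alpha_limsup)
  qed
  then have "eventually (\<lambda>x. 0 < (LBINT y. (1 - ((1 + \<bar>x + y\<bar>) / (1 + \<bar>x\<bar>)) powr (- \<beta>)) * f x y)) at_infinity"
    using beta by (intro eventually_drift_positive[OF _ alpha_limsup alpha_limsup_less _ _ c_pos dens unif drift])
      (auto simp: alpha)
  from transient_jump_chain[where \<beta> = \<beta> and r\<^sub>0 = "max r (k + 1)", OF chain dens right far beta(1) this]
  show ?thesis .
qed

end
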